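(* In the setting of the context, suppose that: (i) for all $X\in\mathcal X^n$, $f_X$ is $(\overline H_0,c_0,r)$-upper smooth over $\Omega$ (with $\overline H_0,c_0,r$ not depending on $X$, $\overline H_0$ positive definite), and each $g_j$ ($j=1,\dots,d$) is $(\overline H_j,c_j,0)$-upper smooth over $\Omega$; (ii) for all $X\in\mathcal X^n$, $f_X$ is $\underline H_0$-strongly convex, and each $g_j$ ($j=1,\dots,d$) is $\underline H_j$-strongly convex, with $\underline H_0$ positive definite and $\underline H_1,\dots,\underline H_d$ positive semidefinite; (iii) the penalty is quadratic, i.e. $\overline H_j=\underline H_j$ and $c_j=0$ for all $j=1,\dots,d$; (iv) $U\subset\mathbb R^p$ is a symmetric neighborhood of the origin with $\Omega+U\subset\Omega_0$. Then for all $X\in\mathcal X^n$ and all $\lambda\in\mathbb A$, $$\bar{\mathcal L}(X|\lambda)-\mathcal L(X|\lambda)\;\le\;c_0+\frac12\log\frac{\det\overline H_0}{\det\underline H_0}-\log R(\overline H_0;U)-\log\inf_{\psi\in\Omega+U}T(\psi).$$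
   Context: Setting. $\overline{\mathbb R}=\mathbb R\cup\{\infty\}$. $\mathcal X^n$ is a data space with base measure $\nu$. For each $X\in\mathcal X^n$, $f_X:\mathbb R^p\to\overline{\mathbb R}$ is a loss function that is a log-loss: there is a closed set $\Omega_0\subset\mathbb R^p$ with $\int_{\mathcal X^n}e^{-f_X(\theta)}\,d\nu(X)=1$ for all $\theta\in\Omega_0$. The parameter domain is $\Omega\subset\Omega_0$, with interior $\mathrm{int}\,\Omega$. The penalty is $g(\theta,\lambda)=\sum_{j=1}^d\lambda_jg_j(\theta)$ with $g_j:\mathbb R^p\to\overline{\mathbb R}$ and $\lambda\in\mathbb A$, where $\mathbb A\subset\mathbb R^d_+$ is a convex set; $\lambda_\star=\inf\mathbb A$ is the (coordinatewise) infimum. For every $X$ and every $\lambda\in\mathbb A$ (and $\lambda=\lambda_\star$) a minimizer of $f_X(\theta)+g(\theta,\lambda)$ over $\theta\in\Omega$ is assumed to exist; one is denoted $\hat\theta(X,\lambda)$. Regular penalty assumption: if $\hat\theta(X,\lambda)\in\mathrm{int}\,\Omega$, then $\hat\theta(X,\lambda')\in\mathrm{int}\,\Omega$ for all $\lambda'\ge\lambda$ (coordinatewise). Measurability needed for the integrals to make sense is implicit. Upper smoothness: $f:\mathbb R^p\to\overline{\mathbb R}$ is $(\overline H,c,r)$-upper smooth over $\Omega$, where $\overline H$ is symmetric positive semidefinite, $c\ge0$, and $r:\mathbb R\to[0,\infty]$ is monotone increasing with $r(t^2)=o(t^2)$ as $t\to0$, if there is $\xi:\mathbb R^p\to\mathbb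 R^p$ with $$f(\psi)-f(\theta)\le c+\langle\xi(\theta),\psi-\theta\rangle+\tfrac12\|\psi-\theta\|_{\overline H}^2+r(\|\theta-\psi\|^2)\quad\forall\psi\in\mathbb R^p,\ \forall\theta\in\Omega,$$ where $\|v\|_H^2=v^\top Hv$. Strong convexity: $f$ is $\underline H$-strongly convex if there is $\xi:\mathbb R^p\to\mathbb R^p$ with $f(\psi)-f(\theta)\ge\langle\xi(\theta),\psi-\theta\rangle+\tfrac12\|\psi-\theta\|_{\underline H}^2$ for all $\psi\in\mathbb R^p$, $\theta\in\Omega$. For families $f_X$, $\xi$ may depend on $X$. Quantities: $Z(\lambda)=\int_{\mathcal X^n}\max_{\theta\in\Omega}\exp\{-f_X(\theta)-g(\theta,\lambda)\}\,d\nu(X)$; $R(H;U)=\mathbb E_{z\sim\mathcal N_p(0,H^{-1})}[\mathbf 1_U(z)e^{-r(\|z\|^2)}]$; $\overline H(\lambda)=\overline H_0+\sum_j\lambda_j\overline H_j$, $c(\lambda)=c_0+\sum_j\lambda_jc_j$; $$\bar Z(\lambda)=\frac{e^{c(\lambda)}\det(\overline H(\lambda))^{1/2}}{(2\pi)^{p/2}R(\overline H_0;U)}\int_{\Omega+U}e^{-g(\theta,\lambda)}d\theta .$$ The LNML code length is $\mathcal L(X|\lambda)=\min_{\theta\in\Omega}\{f_X(\theta)+g(\theta,\lambda)\}+\log Z(\lambda)$ and its upper bound uLNML is $\bar{\mathcal L}(X|\lambda)=\min_{\theta\in\Omega}\{f_X(\theta)+g(\theta,\lambda)\}+\log\bar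 Z(\lambda)$. $T(\psi)=\int_{\{X:\hat\theta(X,\lambda_\star)\in\mathrm{int}\,\Omega\}}e^{-f_X(\psi)}\,d\nu(X)$.
   Formalization: When c_0>0 it is additionally assumed that \overline H_0-\underline H_0 is positive semidefinite (automatic for c_0=0); without this the stated bound can fail, e.g. for a Gaussian location loss with ridge penalty, \underline H_0=10, \overline H_0=1, c_0=9/2. *)

theory Defs
  imports "HOL-Analysis.Analysis"
begin

(* exp and log on the extended line: exp(-\<infinity>) = 0, exp \<infinity> = \<infinity>, log 0 = -\<infinity>, log \<infinity> = \<infinity> *)

definition eexp :: "ereal \<Rightarrow> ennreal" where
  "eexp x = (case x of ereal y \<Rightarrow> ennreal (exp y) | PInfty \<Rightarrow> \<infinity> | MInfty \<Rightarrow> 0)"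

definition elog :: "ennreal \<Rightarrow> ereal" where
  "elog x = (if x = 0 then -\<infinity> else if x = \<infinity> then \<infinity> else ereal (ln (enn2real x)))"

definition psd :: "real^'p^'p \<Rightarrow> bool" where
  "psd H \<longleftrightarrow> transpose H = H \<and> (\<forall>v. 0 \<le> v \<bullet> (H *v v))"

definition pd :: "real^'p^'p \<Rightarrow> bool" where
  "pd H \<longleftrightarrow> transpose H = H \<and> (\<forall>v. v \<noteq> 0 \<longrightarrow> 0 < v \<bullet> (H *v v))"

(* On ereal, \<infinity> - \<infinity> = \<infinity>. Since r vanishes at 0, the inequality at \<psi> = \<theta> therefore makes
   an upper smooth function different from \<infinity> on \<Omega>; off \<Omega> the value \<infinity> remains possible. *)
definition upper_smooth ::
  "real^'p^'p \<Rightarrow> real \<Rightarrow> (real \<Rightarrow> ennreal) \<Rightarrow> (real^'p) set \<Rightarrow> (real^'p \<Rightarrow> ereal) \<Rightarrow> bool" where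
  "upper_smooth H c r \<Omega> f \<longleftrightarrow>
     psd H \<and> 0 \<le> c \<and> mono r \<and> ((\<lambda>t::real. r (t\<^sup>2) / ennreal (t\<^sup>2)) \<longlongrightarrow> 0) (at 0) \<and>
     (\<exists>\<xi> :: real^'p \<Rightarrow> real^'p. \<forall>\<psi>. \<forall>\<theta>\<in>\<Omega>.
        f \<psi> - f \<theta> \<le> ereal (c + \<xi> \<theta> \<bullet> (\<psi> - \<theta>) + 1/2 * ((\<psi> - \<theta>) \<bullet> (H *v (\<psi> - \<theta>))))
                      + enn2ereal (r ((norm (\<theta> - \<psi>))\<^sup>2)))"

definition strongly_convex :: "real^'p^'p \<Rightarrow> (real^'p) set \<Rightarrow> (real^'p \<Rightarrow> ereal) \<Rightarrow> bool" where
  "strongly_convex H \<Omega> f \<longleftrightarrow>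
     (\<exists>\<xi> :: real^'p \<Rightarrow> real^'p. \<forall>\<psi>. \<forall>\<theta>\<in>\<Omega>.
        f \<psi> - f \<theta> \<ge> ereal (\<xi> \<theta> \<bullet> (\<psi> - \<theta>) + 1/2 * ((\<psi> - \<theta>) \<bullet> (H *v (\<psi> - \<theta>)))))"

(* ereal has 0 * \<infinity> = 0: a penalty with weight 0 is absent. *)
definition penalty :: "('d::finite \<Rightarrow> real^'p \<Rightarrow> ereal) \<Rightarrow> real^'p \<Rightarrow> real^'d \<Rightarrow> ereal" where
  "penalty g \<theta> l = (\<Sum>j\<in>UNIV. ereal (l $ j) * g j \<theta>)"

definition normalizer ::
  "'x measure \<Rightarrow> ('x \<Rightarrow> real^'p \<Rightarrow> ereal) \<Rightarrow> ('d::finite \<Rightarrow> real^'p \<Rightarrow> ereal) \<Rightarrow>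
   (real^'p) set \<Rightarrow> real^'d \<Rightarrow> ennreal" where
  "normalizer \<nu> f g \<Omega> l = (\<integral>\<^sup>+X. (SUP \<theta>\<in>\<Omega>. eexp (- f X \<theta> - penalty g \<theta> l)) \<partial>\<nu>)"

(* N(0,S) for positive definite S, as a measure on the Lebesgue sets *)
definition centered_normal :: "real^'p^'p \<Rightarrow> (real^'p) measure" where
  "centered_normal S = density lebesgue
     (\<lambda>z. ennreal (exp (- (z \<bullet> (matrix_inv S *v z)) / 2) / sqrt ((2 * pi) ^ CARD('p) * det S)))"

definition R_factor :: "(real \<Rightarrow> ennreal) \<Rightarrow> real^'p^'p \<Rightarrow> (real^'p) set \<Rightarrow> ennreal" where
  "R_factor r H U =
     (\<integral>\<^sup>+z. indicator U z * eexp (- enn2ereal (r ((norm z)\<^sup>2))) \<partial>centered_normal (matrix_inv H))"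

definition H_comb :: "real^'p^'p \<Rightarrow> ('d::finite \<Rightarrow> real^'p^'p) \<Rightarrow> real^'d \<Rightarrow> real^'p^'p" where
  "H_comb H0 H l = H0 + (\<Sum>j\<in>UNIV. (l $ j) *\<^sub>R H j)"

definition c_comb :: "real \<Rightarrow> ('d::finite \<Rightarrow> real) \<Rightarrow> real^'d \<Rightarrow> real" where
  "c_comb c0 c l = c0 + (\<Sum>j\<in>UNIV. l $ j * c j)"

definition normalizer_bound ::
  "('d::finite \<Rightarrow> real^'p \<Rightarrow> ereal) \<Rightarrow> (real^'p) set \<Rightarrow> (real^'p) set \<Rightarrow>
   real^'p^'p \<Rightarrow> ('d \<Rightarrow> real^'p^'p) \<Rightarrow> real \<Rightarrow> ('d \<Rightarrow> real) \<Rightarrow> (real \<Rightarrow> ennreal) \<Rightarrow>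
   real^'d \<Rightarrow> ennreal" where
  "normalizer_bound g \<Omega> U H0 H c0 c r l =
     ennreal (exp (c_comb c0 c l) * sqrt (det (H_comb H0 H l)))
       / (ennreal ((2 * pi) powr (real CARD('p) / 2)) * R_factor r H0 U)
     * (\<integral>\<^sup>+\<theta>\<in>\<Omega> + U. eexp (- penalty g \<theta> l) \<partial>lebesgue)"

definition LNML ::
  "'x measure \<Rightarrow> ('x \<Rightarrow> real^'p \<Rightarrow> ereal) \<Rightarrow> ('d::finite \<Rightarrow> real^'p \<Rightarrow> ereal) \<Rightarrow>
   (real^'p) set \<Rightarrow> 'x \<Rightarrow> real^'d \<Rightarrow> ereal" where
  "LNML \<nu> f g \<Omega> X l =
     (INF \<theta>\<in>\<Omega>. f X \<theta> + penalty g \<theta> l) + elog (normalizer \<nu> f g \<Omega> l)"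

definition uLNML ::
  "('x \<Rightarrow> real^'p \<Rightarrow> ereal) \<Rightarrow> ('d::finite \<Rightarrow> real^'p \<Rightarrow> ereal) \<Rightarrow>
   (real^'p) set \<Rightarrow> (real^'p) set \<Rightarrow>
   real^'p^'p \<Rightarrow> ('d \<Rightarrow> real^'p^'p) \<Rightarrow> real \<Rightarrow> ('d \<Rightarrow> real) \<Rightarrow> (real \<Rightarrow> ennreal) \<Rightarrow>
   'x \<Rightarrow> real^'d \<Rightarrow> ereal" where
  "uLNML f g \<Omega> U H0 H c0 c r X l =
     (INF \<theta>\<in>\<Omega>. f X \<theta> + penalty g \<theta> l) + elog (normalizer_bound g \<Omega> U H0 H c0 c r l)"

definition T_mass ::
  "'x measure \<Rightarrow> ('x \<Rightarrow> real^'p \<Rightarrow> ereal) \<Rightarrow> (real^'p) set \<Rightarrow> ('x \<Rightarrow> real^'d \<Rightarrow> real^'p) \<Rightarrow>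
   real^'d \<Rightarrow> real^'p \<Rightarrow> ennreal" where
  "T_mass \<nu> f \<Omega> \<theta>hat lstar \<psi> =
     (\<integral>\<^sup>+X\<in>{X \<in> space \<nu>. \<theta>hat X lstar \<in> interior \<Omega>}. eexp (- f X \<psi>) \<partial>\<nu>)"

end

(* The ratio of the two normalizers is bounded by exchanging the order of integration:
   (inf T) * (integral of e^(-g) over Omega + U) is at most the integral over X of the psi-integral of
   e^(-(f_X + g)(psi)). For X in the domain of T the minimizer theta is interior, and strong convexity
   gives (f_X + g)(psi) >= (f_X + g)(theta) + |psi - theta|^2 / 2 in the norm of Hlow(lambda), so the
   psi-integral is at most (2 pi)^(p/2) / sqrt(det(Hlow(lambda))) times the maximum of e^(-(f_X + g)).
   Both curvature matrices grow by the same G >= 0 since the penalty is quadratic, and det(A + G) / det A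
   is decreasing in A, which replaces Hup(lambda), Hlow(lambda) by Hup0, Hlow0.

   The Gaussian integral and the determinant ratio are both computed one rank-one update u u^T at a time. *)

theory Submission
  imports Defs "HOL-Probability.Distributions"
begin

subsection \<open>Positive semidefinite matrices\<close>

text \<open>The integration runs over \<open>\<Omega> + U\<close>, where \<open>f X\<close> may be
  \<infinity>, so the quadratic growth from the minimizer has to hold at arbitrary \<psi>, while
  both minimality and finiteness are known only on \<Omega>. Interiority bridges this gap: a segment
  towards any \<psi> starts inside \<Omega>. Exchanging the integrals calls for a sigma-finite
  \<nu>, which the log-loss condition supplies, since exp(-f) at a point of \<Omega> is strictly
  positive with integral 1. The determinant comparison rests on \<open>Hup0 - Hlow0\<close> being
  positive semidefinite. For \<open>c0 = 0\<close> the two bounds on \<open>f X\<close> force this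
  near any point of \<Omega>; a positive \<open>c0\<close> leaves slack in the upper bound that does
  not shrink near the point, and there the order is assumed. Passing to logarithms meets degenerate
  values: a vanishing R or inf T, or an infinite normalizer, makes the right side \<infinity>, while
  R and inf T are shown to be finite, so neither sends it to -\<infinity>.\<close>

definition outer :: "real^'n \<Rightarrow> real^'n^'n" where
  "outer u = (\<chi> i j. u $ i * u $ j)"

lemma outer_mult_vec: "outer u *v x = (u \<bullet> x) *\<^sub>R u"
  by (simp add: outer_def vec_eq_iff matrix_vector_mult_def inner_vec_def sum_distrib_right
      sum_distrib_left mult_ac)

lemma transpose_outer [simp]: "transpose (outer u) = outer u"
  by (simp add: outer_def transpose_def vec_eq_iff mult.commute)

lemma symmetric_inner_swap:
  fixes A :: "real^'n^'n"
  assumes "transpose A = A"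
  shows "x \<bullet> (A *v y) = y \<bullet> (A *v x)"
  by (metis assms dot_lmul_matrix inner_commute transpose_matrix_vector)

lemma transpose_add: "transpose (A + B) = transpose A + transpose (B :: real^'n^'m)"
  by (simp add: transpose_def vec_eq_iff)

lemma transpose_diff: "transpose (A - B) = transpose A - transpose (B :: real^'n^'m)"
  by (simp add: transpose_def vec_eq_iff)

lemma transpose_scaleR: "transpose (a *\<^sub>R B) = a *\<^sub>R transpose (B :: real^'n^'m)"
  by (simp add: transpose_def vec_eq_iff)

lemma scaleR_matrix_vector_mult: "(a *\<^sub>R A) *v x = a *\<^sub>R (A *v (x :: real^'n))"
  by (simp add: scaleR_matrix_vector_assoc)

lemma psd_outer: "psd (outer u)"
  by (simp add: psd_def outer_mult_vec inner_commute flip: power2_eq_square)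

lemma psd_0: "psd 0"
  by (simp add: psd_def transpose_def vec_eq_iff)

lemma psd_add: "psd A \<Longrightarrow> psd B \<Longrightarrow> psd (A + B)"
  by (simp add: psd_def transpose_add matrix_vector_mult_add_rdistrib inner_add_right)

lemma psd_scaleR: "psd A \<Longrightarrow> 0 \<le> a \<Longrightarrow> psd (a *\<^sub>R A)"
  by (simp add: psd_def transpose_scaleR scaleR_matrix_vector_mult)

lemma psd_sum: "(\<And>j. j \<in> S \<Longrightarrow> psd (F j)) \<Longrightarrow> psd (\<Sum>j\<in>S. F j)"
  by (induction S rule: infinite_finite_induct) (auto simp: psd_0 psd_add)

lemma pd_imp_psd: "pd A \<Longrightarrow> psd A"
  unfolding pd_def psd_def by (metis inner_zero_left order.refl less_imp_le)

lemma pd_add_psd: "pd A \<Longrightarrow> psd B \<Longrightarrow> pd (A + B)"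
  by (simp add: psd_def pd_def transpose_add matrix_vector_mult_add_rdistrib inner_add_right add_pos_nonneg)

text \<open>On the span of \<open>x\<close> and \<open>y\<close> the form is a nonnegative binary
  quadratic, so its discriminant cannot be positive. Since \<open>A\<close> may be singular,
  \<open>a = 0\<close> is a separate case.\<close>

lemma psd_Cauchy_Schwarz:
  assumes "psd A"
  shows "(x \<bullet> (A *v y))\<^sup>2 \<le> (x \<bullet> (A *v x)) * (y \<bullet> (A *v y))"
proof -
  define a b d where "a = x \<bullet> (A *v x)" and "b = x \<bullet> (A *v y)" and "d = y \<bullet> (A *v y)"
  have sym: "y \<bullet> (A *v x) = b"
    using assms symmetric_inner_swap[of A x y] by (simp add: psd_def b_def)
  have q: "0 \<le> a * s\<^sup>2 + 2 * b * s * t + d * t\<^sup>2" for s t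
  proof -
    have "0 \<le> (s *\<^sub>R x + t *\<^sub>R y) \<bullet> (A *v (s *\<^sub>R x + t *\<^sub>R y))"
      using assms by (simp only: psd_def)
    also have "\<dots> = a * s\<^sup>2 + 2 * b * s * t + d * t\<^sup>2"
      by (simp add: matrix_vector_right_distrib inner_add_left inner_add_right matrix_vector_mult_scaleR
          a_def[symmetric] b_def[symmetric] d_def[symmetric] sym power2_eq_square algebra_simps)
    finally show ?thesis .
  qed
  have a: "0 \<le> a" and d: "0 \<le> d" using assms by (auto simp: psd_def a_def d_def)
  have "b\<^sup>2 \<le> a * d"
  proof (cases "a = 0")
    case False
    \<comment> \<open>The choice \<open>s = b\<close>, \<open>t = - a\<close> turns the form into
      \<open>a\<close> times the gap to be shown nonnegative.\<close>
    have "0 \<le> a * b\<^sup>2 + 2 * b * b * (- a) + d * (- a)\<^sup>2"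
      using q[of b "- a"] by simp
    also have "\<dots> = a * (a * d - b\<^sup>2)" by (simp add: power2_eq_square algebra_simps)
    finally show ?thesis using False a by (simp add: zero_le_mult_iff)
  next
    case True
    have "b = 0"
    proof (rule ccontr)
      assume "b \<noteq> 0"
      then show False
        \<comment> \<open>With \<open>a = 0\<close> this choice gives the form the value
          \<open>- (d + 1) + d = - 1\<close>.\<close>
        using q[of "- (d + 1) / (2 * b)" 1] True by (simp add: field_simps)
    qed
    then show ?thesis using True by simp
  qed
  then show ?thesis by (simp add: a_def b_def d_def)
qed

text \<open>One step of Cholesky elimination per index: subtracting \<open>G e\<^sub>k e\<^sub>k\<^sup>T G / G\<^sub>k\<^sub>k\<close>
  clears row \<open>k\<close> and keeps the matrix positive semidefinite.\<close>

lemma psd_induct [consumes 1, case_names zero outer]: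
  fixes G :: "real^'n^'n"
  assumes "psd G" and zero: "P 0"
    and step: "\<And>G u. psd G \<Longrightarrow> P G \<Longrightarrow> P (G + outer u)"
  shows "P G"
proof -
  \<comment> \<open>Induction on the set \<open>S\<close> of columns not yet known to vanish; each
    elimination step removes one index from it.\<close>
  have "P G" if "finite S" "psd G" "\<And>i. i \<notin> S \<Longrightarrow> G *v axis i 1 = 0" for S and G :: "real^'n^'n"
    using that
  proof (induction S arbitrary: G rule: finite_induct)
    case empty
    then have "G = 0"
      by (metis empty_iff matrix_vector_mult_basis column_def vec_eq_iff vec_lambda_beta zero_index)
    then show ?case using zero by simp
  next
    case (insert k S)
    let ?e = "\<lambda>i. axis i 1 :: real^'n"
    define q where "q = ?e k \<bullet> (G *v ?e k)"
    have sym: "transpose G = G" and nn: "\<And>v. 0 \<le> v \<bullet> (G *v v)"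
      using insert.prems by (auto simp: psd_def)
    show ?case
    proof (cases "q = 0")
      case True
      \<comment> \<open>A zero pivot forces its whole column to vanish, by Cauchy-Schwarz against
        \<open>?e k\<close>, so nothing has to be subtracted.\<close>
      have "G *v ?e k = 0"
      proof -
        have "((G *v ?e k) \<bullet> (G *v ?e k))\<^sup>2 \<le> 0"
          using psd_Cauchy_Schwarz[OF insert.prems(1), of "G *v ?e k" "?e k"] True
          by (simp add: q_def)
        then show ?thesis by simp
      qed
      then show ?thesis
        using insert.IH[OF insert.prems(1)] insert.prems(2) by (metis insert_iff)
    next
      case False
      then have q: "q > 0" using nn[of "?e k"] by (simp add: q_def)
      define u where "u = (1 / sqrt q) *\<^sub>R (G *v ?e k)"
      define G' where "G' = G - outer u"
      have G'x: "G' *v x = G *v x - ((x \<bullet> (G *v ?e k)) / q) *\<^sub>R (G *v ?e k)" for x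
        using q by (simp add: G'_def matrix_vector_mult_diff_rdistrib outer_mult_vec u_def inner_commute)
      have "psd G'"
        unfolding psd_def
      proof (intro conjI allI)
        show "transpose G' = G'" by (simp add: G'_def transpose_diff sym)
        fix x
        show "0 \<le> x \<bullet> (G' *v x)"
          using psd_Cauchy_Schwarz[OF insert.prems(1), of x "?e k"] q
          by (simp add: G'x inner_diff_right field_simps power2_eq_square flip: q_def)
      qed
      moreover have "G' *v ?e i = 0" if "i \<notin> S" for i
      proof (cases "i = k")
        case True
        then show ?thesis using q by (simp add: G'x flip: q_def)
      next
        case False
        then have "G *v ?e i = 0" using insert.prems(2) that by auto
        moreover have "?e i \<bullet> (G *v ?e k) = ?e k \<bullet> (G *v ?e i)"
          by (rule symmetric_inner_swap[OF sym])
        ultimately show ?thesis by (simp add: G'x)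
      qed
      ultimately have "P (G' + outer u)"
        using insert.IH step by blast
      then show ?thesis by (simp add: G'_def)
    qed
  qed
  from this[of UNIV G] assms(1) show ?thesis by simp
qed

section \<open>Determinants under rank-one updates\<close>

lemma matrix_add_rdistrib:
  fixes A B :: "real^'n^'m" and C :: "real^'k^'n"
  shows "(A + B) ** C = A ** C + B ** C"
  by (simp add: vec_eq_iff matrix_matrix_mult_def sum.distrib distrib_right)

text \<open>The matrix \<open>P\<close>, the identity with column \<open>k\<close> replaced by
  \<open>y\<close>, sends the unit vector at \<open>k\<close> to \<open>y\<close>. Conjugating by it
  replaces \<open>y\<close> by that unit vector and \<open>u\<close> by \<open>w\<close>, and then
  only one row differs from the identity. The index \<open>k\<close> is chosen with
  \<open>y $ k \<noteq> 0\<close>, which is the determinant of \<open>P\<close>.\<close>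

lemma det_identity_plus_rank_one:
  fixes u y :: "real^'n"
  shows "det (mat 1 + (\<chi> i j. y $ i * u $ j)) = 1 + u \<bullet> y"
proof (cases "y = 0")
  case True
  then have "(\<chi> i j. y $ i * u $ j) = 0" by (simp add: vec_eq_iff)
  then show ?thesis using True by simp
next
  case False
  then obtain k where k: "y $ k \<noteq> 0" by (auto simp: vec_eq_iff)
  define P :: "real^'n^'n" where "P = (\<chi> i j. if j = k then y $ i else mat 1 $ i $ j)"
  have replace_column: "det (\<chi> i j. if j = k then x $ i else (mat 1 :: real^'n^'n) $ i $ j) = x $ k" for x
    using cramer_lemma[of k "mat 1 :: real^'n^'n" x] unfolding matrix_vector_mul_lid det_I mult_1_right .
  define w where "w = transpose P *v u"
  have "transpose (mat 1 + (\<chi> i j. axis k 1 $ i * w $ j)) =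
      (\<chi> i j. if j = k then (axis k 1 + w) $ i else (mat 1 :: real^'n^'n) $ i $ j)"
    by (auto simp: vec_eq_iff transpose_def mat_def axis_def)
  then have "det (transpose (mat 1 + (\<chi> i j. axis k 1 $ i * w $ j))) = (axis k 1 + w) $ k"
    by (simp only: replace_column)
  then have 1: "det (mat 1 + (\<chi> i j. axis k 1 $ i * w $ j)) = 1 + w $ k"
    by (simp only: det_transpose vector_add_component axis_nth)
  have wk: "w $ k = u \<bullet> y"
    by (simp add: w_def P_def matrix_vector_mult_def transpose_def inner_vec_def mult.commute)
  have w: "(\<Sum>l\<in>UNIV. u $ l * P $ l $ j) = w $ j" for j
    by (simp add: w_def matrix_vector_mult_def transpose_def mult.commute)
  have Pe: "(\<Sum>l\<in>UNIV. P $ i $ l * axis k 1 $ l) = y $ i" for i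
    by (simp add: axis_def if_distrib[of "(*) _"] P_def cong: if_cong)
  have "(mat 1 + (\<chi> i j. y $ i * u $ j)) ** P = P + (\<chi> i j. y $ i * w $ j)"
    by (simp add: matrix_add_rdistrib) (simp add: vec_eq_iff matrix_matrix_mult_def mult.assoc w flip: sum_distrib_left)
  also have "\<dots> = P ** (mat 1 + (\<chi> i j. axis k 1 $ i * w $ j))"
    by (simp add: matrix_add_ldistrib) (simp add: vec_eq_iff matrix_matrix_mult_def Pe flip: mult.assoc sum_distrib_right)
  finally have "(mat 1 + (\<chi> i j. y $ i * u $ j)) ** P = P ** (mat 1 + (\<chi> i j. axis k 1 $ i * w $ j))" .
  from arg_cong[OF this, of det]
  have "det (mat 1 + (\<chi> i j. y $ i * u $ j)) * det P = det P * (1 + u \<bullet> y)"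
    by (simp only: det_mul 1 wk)
  moreover have "det P = y $ k" unfolding P_def by (rule replace_column)
  ultimately show ?thesis using k by simp
qed

text \<open>Here \<open>y\<close> stands for the inverse of \<open>A\<close> applied to
  \<open>u\<close>, so that \<open>A\<close> factors out on the left and leaves a rank-one change of
  the identity. The factor \<open>s\<close> is used with the values 1 and -1.\<close>

lemma det_plus_outer:
  fixes A :: "real^'n^'n"
  assumes "A *v y = u"
  shows "det (A + s *\<^sub>R outer u) = det A * (1 + s * (u \<bullet> y))"
proof -
  have "(\<Sum>k\<in>UNIV. A $ i $ k * y $ k) = u $ i" for i
    using assms by (auto simp: matrix_vector_mult_def vec_eq_iff)
  moreover have "(\<Sum>k\<in>UNIV. A $ i $ k * (y $ k * (s * u $ j))) = (\<Sum>k\<in>UNIV. A $ i $ k * y $ k) * (s * u $ j)" for i j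
    by (simp only: sum_distrib_right mult.assoc)
  ultimately have "(\<Sum>k\<in>UNIV. A $ i $ k * (y $ k * (s * u $ j))) = s * (u $ i * u $ j)" for i j
    by (simp only: mult_ac)
  then have "A ** (\<chi> i j. y $ i * (s *\<^sub>R u) $ j) = s *\<^sub>R outer u"
    by (simp add: vec_eq_iff matrix_matrix_mult_def outer_def)
  then have "A ** (mat 1 + (\<chi> i j. y $ i * (s *\<^sub>R u) $ j)) = A + s *\<^sub>R outer u"
    by (simp add: matrix_add_ldistrib)
  from arg_cong[OF this, of det] show ?thesis
    by (simp only: det_mul det_identity_plus_rank_one inner_scaleR_left)
qed

lemma pd_solve:
  fixes A :: "real^'n^'n"
  assumes "pd A"
  obtains y where "A *v y = u"
proof -
  have "x = 0" if "A *v x = 0" for x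
    using assms that by (metis pd_def inner_zero_right less_irrefl)
  then have "inj ((*v) A)"
    by (metis (no_types, lifting) injI matrix_vector_mult_diff_distrib right_minus_eq)
  then have "surj ((*v) A)"
    by (simp add: linear_injective_imp_surjective)
  then show ?thesis using that by (metis surjD)
qed

subsection \<open>Gaussian integrals and determinant ratios\<close>

text \<open>Testing positivity of \<open>A - outer u\<close> on \<open>y\<close> itself gives
  \<open>q - q\<^sup>2 > 0\<close> for \<open>q = u \<bullet> y\<close>. This keeps the factor
  \<open>1 - q\<close> of a downdated determinant positive.\<close>

lemma pd_minus_outer_solution_less_1:
  fixes A :: "real^'n^'n"
  assumes "pd (A - outer u)" "A *v y = u"
  shows "u \<bullet> y < 1"
proof -
  let ?q = "u \<bullet> y"
  have *: "y \<noteq> 0 \<Longrightarrow> 0 < ?q * (1 - ?q)"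
    using assms(1)[unfolded pd_def, THEN conjunct2, rule_format, of y] assms(2)
    by (simp add: matrix_vector_mult_diff_rdistrib outer_mult_vec inner_diff_right inner_commute algebra_simps)
  show "u \<bullet> y < 1"
    using * by (cases "y = 0") (auto simp: zero_less_mult_iff)
qed

section \<open>Gaussian integrals, in one dimension and in several\<close>

lemma nn_integral_exp_quadratic:
  fixes a m :: real
  assumes "a > 0"
  shows "(\<integral>\<^sup>+x. ennreal (exp (- (a * (x - m)\<^sup>2) / 2)) \<partial>lborel) = ennreal (sqrt (2 * pi / a))"
proof -
  define s where "s = 1 / sqrt a"
  have s: "s > 0" "s\<^sup>2 = 1 / a" using assms by (auto simp: s_def power_divide)
  have "prob_space (density lborel (normal_density m s))"
    using s(1) by (rule prob_space_normal_density)
  then have 1: "(\<integral>\<^sup>+x. ennreal (normal_density m s x) \<partial>lborel) = 1"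
    using prob_space.emeasure_space_1 by (fastforce simp: emeasure_density)
  have "exp (- (a * (x - m)\<^sup>2) / 2) = sqrt (2 * pi / a) * normal_density m s x" for x
    using assms by (simp add: normal_density_def s real_sqrt_divide real_sqrt_mult field_simps)
  then show ?thesis
    using 1 assms by (simp add: ennreal_mult nn_integral_cmult)
qed

text \<open>Completing the square in \<open>t\<close> writes the exponential of a square as a
  mixture of exponentials linear in \<open>s\<close>; it is used with
  \<open>s = u \<bullet> x\<close>.\<close>

lemma exp_square_eq_nn_integral:
  fixes s :: real
  shows "ennreal (exp (s\<^sup>2 / 2)) * ennreal (sqrt (2 * pi)) =
    (\<integral>\<^sup>+t. ennreal (exp (t * s - t\<^sup>2 / 2)) \<partial>lborel)"
proof -
  have "exp (t * s - t\<^sup>2 / 2) = exp (s\<^sup>2 / 2) * exp (- (1 * (t - s)\<^sup>2) / 2)" for t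
    by (simp add: power2_eq_square field_simps flip: exp_add)
  then show ?thesis
    using nn_integral_exp_quadratic[of 1 s]
    by (simp only: ennreal_mult exp_ge_zero) (simp add: nn_integral_cmult)
qed

lemma nn_integral_lborel_shift:
  fixes F :: "'a::euclidean_space \<Rightarrow> ennreal"
  assumes "F \<in> borel_measurable borel"
  shows "(\<integral>\<^sup>+x. F (a + x) \<partial>lborel) = (\<integral>\<^sup>+x. F x \<partial>lborel)"
proof -
  have "(\<integral>\<^sup>+x. F x \<partial>lborel) = (\<integral>\<^sup>+x. F x \<partial>distr lborel borel ((+) a))"
    by (simp add: lborel_distr_plus)
  also have "\<dots> = (\<integral>\<^sup>+x. F (a + x) \<partial>lborel)"
    using assms by (subst nn_integral_distr) auto
  finally show ?thesis by simp
qed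

lemma continuous_quadratic_form [continuous_intros]:
  fixes A :: "real^'n^'n" and F :: "'a::t2_space \<Rightarrow> real^'n"
  shows "continuous_on S F \<Longrightarrow> continuous_on S (\<lambda>x. F x \<bullet> (A *v F x))"
  by (intro continuous_intros matrix_vector_mult_linear_continuous_on[THEN continuous_on_compose2]) auto

lemma borel_quadratic_form [measurable]:
  "(\<lambda>x. x \<bullet> (A *v x)) \<in> borel_measurable borel" for A :: "real^'n^'n"
  by (intro borel_measurable_continuous_onI continuous_intros)

definition gaussian :: "real^'n^'n \<Rightarrow> real^'n \<Rightarrow> ennreal" where
  "gaussian A x = ennreal (exp (- (x \<bullet> (A *v x)) / 2))"

lemma gaussian_measurable [measurable]: "gaussian A \<in> borel_measurable borel"
  unfolding gaussian_def by measurable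

lemma gaussian_integral_scalar:
  assumes "M > 0"
  shows "(\<integral>\<^sup>+x. gaussian (M *\<^sub>R mat 1 :: real^'n^'n) x \<partial>lborel) = ennreal ((2 * pi / M) powr (CARD('n) / 2))"
proof -
  have "gaussian (M *\<^sub>R mat 1) x = (\<Prod>b\<in>Basis. ennreal (exp (- (M * ((x \<bullet> b) - 0)\<^sup>2) / 2)))" for x :: "real^'n"
  proof -
    have "x \<bullet> ((M *\<^sub>R mat 1) *v x) = M * (\<Sum>b\<in>Basis. (x \<bullet> b)\<^sup>2)"
      by (simp add: scaleR_matrix_vector_mult power2_eq_square euclidean_inner[of x x])
    then show ?thesis
      by (simp add: gaussian_def prod_ennreal sum_distrib_left sum_divide_distrib flip: exp_sum sum_negf)
  qed
  then have "(\<integral>\<^sup>+x. gaussian (M *\<^sub>R mat 1 :: real^'n^'n) x \<partial>lborel) =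
      (\<Prod>b\<in>(Basis :: (real^'n) set). (\<integral>\<^sup>+x. ennreal (exp (- (M * (x - 0)\<^sup>2) / 2)) \<partial>lborel))"
    by (simp only:) (subst nn_integral_lborel_prod; simp)
  also have "\<dots> = (\<Prod>b\<in>(Basis :: (real^'n) set). ennreal (sqrt (2 * pi / M)))"
    using assms by (simp only: nn_integral_exp_quadratic)
  also have "\<dots> = ennreal ((2 * pi / M) powr (CARD('n) / 2))"
    using assms by (simp add: ennreal_power powr_half_sqrt[symmetric] powr_powr flip: powr_realpow)
  finally show ?thesis .
qed

text \<open>The Gaussian integral is computed by rank-one downdates from a large multiple of the identity:
  writing the factor \<open>exp ((u \<bullet> x)\<^sup>2 / 2)\<close> as a Gaussian mixture of \<open>exp (t * (u \<bullet> x))\<close>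
  leaves a translated copy of the original integrand for each \<open>t\<close>. The change of variables theorems
  of HOL-Analysis would need a well-order on the index type.\<close>

lemma gaussian_integral_downdate:
  fixes A :: "real^'n^'n"
  assumes A: "pd A" and pd: "pd (A - outer u)" and y: "A *v y = u"
  shows "(\<integral>\<^sup>+x. gaussian (A - outer u) x \<partial>lborel) =
    ennreal (1 / sqrt (1 - u \<bullet> y)) * (\<integral>\<^sup>+x. gaussian A x \<partial>lborel)"
proof -
  define q where "q = u \<bullet> y"
  have q: "q < 1" using pd_minus_outer_solution_less_1[OF pd y] by (simp add: q_def)
  let ?c = "ennreal (sqrt (2 * pi))" and ?I = "\<integral>\<^sup>+x. gaussian A x \<partial>lborel"
  have sym: "x \<bullet> (A *v z) = z \<bullet> (A *v x)" for x z
    using A by (intro symmetric_inner_swap) (simp add: pd_def)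
  have "?c * (\<integral>\<^sup>+x. gaussian (A - outer u) x \<partial>lborel) =
      (\<integral>\<^sup>+x. gaussian A x * (ennreal (exp ((u \<bullet> x)\<^sup>2 / 2)) * ?c) \<partial>lborel)"
  proof (subst nn_integral_cmult[symmetric]; (intro nn_integral_cong)?)
    fix x :: "real^'n"
    have "x \<bullet> ((A - outer u) *v x) = x \<bullet> (A *v x) - (u \<bullet> x)\<^sup>2"
      by (simp add: matrix_vector_mult_diff_rdistrib outer_mult_vec inner_diff_right power2_eq_square inner_commute)
    then have "exp (- (x \<bullet> ((A - outer u) *v x)) / 2) = exp (- (x \<bullet> (A *v x)) / 2) * exp ((u \<bullet> x)\<^sup>2 / 2)"
      by (simp add: diff_divide_distrib flip: exp_add)
    then show "?c * gaussian (A - outer u) x = gaussian A x * (ennreal (exp ((u \<bullet> x)\<^sup>2 / 2)) * ?c)"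
      by (simp add: gaussian_def ennreal_mult mult_ac)
  qed simp
  also have "\<dots> = (\<integral>\<^sup>+x. (\<integral>\<^sup>+t. gaussian A x * ennreal (exp (t * (u \<bullet> x) - t\<^sup>2 / 2)) \<partial>lborel) \<partial>lborel)"
    by (simp add: exp_square_eq_nn_integral nn_integral_cmult)
  also have "\<dots> = (\<integral>\<^sup>+t. (\<integral>\<^sup>+x. gaussian A x * ennreal (exp (t * (u \<bullet> x) - t\<^sup>2 / 2)) \<partial>lborel) \<partial>lborel)"
    by (intro lborel_pair.Fubini') measurable
  \<comment> \<open>Completing the square in \<open>x\<close> moves the centre to
    \<open>t *\<^sub>R y\<close> and costs \<open>t\<^sup>2 * q / 2\<close>, which combines with
    \<open>- t\<^sup>2 / 2\<close> into a Gaussian in \<open>t\<close>, integrable because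
    \<open>q < 1\<close>.\<close>
  also have "\<dots> = (\<integral>\<^sup>+t. (\<integral>\<^sup>+x. ennreal (exp (- ((1 - q) * (t - 0)\<^sup>2) / 2)) * gaussian A (- (t *\<^sub>R y) + x) \<partial>lborel) \<partial>lborel)"
  proof (intro nn_integral_cong)
    fix t :: real and x :: "real^'n"
    have "(x - t *\<^sub>R y) \<bullet> (A *v (x - t *\<^sub>R y)) = x \<bullet> (A *v x) - 2 * t * (u \<bullet> x) + t\<^sup>2 * q"
      using sym[of y x] y
      by (simp add: matrix_vector_mult_diff_distrib inner_diff_left inner_diff_right matrix_vector_mult_scaleR
          q_def inner_commute power2_eq_square algebra_simps)
    then show "gaussian A x * ennreal (exp (t * (u \<bullet> x) - t\<^sup>2 / 2)) =
        ennreal (exp (- ((1 - q) * (t - 0)\<^sup>2) / 2)) * gaussian A (- (t *\<^sub>R y) + x)"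
      by (simp add: gaussian_def field_simps flip: ennreal_mult exp_add)
  qed
  also have "\<dots> = (\<integral>\<^sup>+t. ennreal (exp (- ((1 - q) * (t - 0)\<^sup>2) / 2)) * ?I \<partial>lborel)"
    by (simp add: nn_integral_cmult nn_integral_lborel_shift del: add_uminus_conv_diff uminus_add_conv_diff)
  also have "\<dots> = ennreal (sqrt (2 * pi / (1 - q))) * ?I"
    using q nn_integral_exp_quadratic[of "1 - q" 0] by (subst nn_integral_multc) auto
  also have "\<dots> = ?c * (ennreal (1 / sqrt (1 - q)) * ?I)"
    using q by (simp add: real_sqrt_divide field_simps flip: ennreal_mult mult.assoc)
  finally show ?thesis
    by (subst (asm) ennreal_mult_cancel_left) (auto simp: q_def)
qed

lemma gaussian_integral:
  fixes H :: "real^'n^'n"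
  assumes "pd H"
  shows "det H > 0"
    and "(\<integral>\<^sup>+x. gaussian H x \<partial>lborel) = ennreal ((2 * pi) powr (CARD('n) / 2) / sqrt (det H))"
proof -
  define M where "M = onorm ((*v) H) + 1"
  have bl: "bounded_linear ((*v) H)" by simp
  have M: "M > 0" using onorm_pos_le[OF bl] by (simp add: M_def)
  have le: "x \<bullet> (H *v x) \<le> M * (x \<bullet> x)" for x
  proof -
    have "x \<bullet> (H *v x) \<le> norm x * norm (H *v x)" by (rule norm_cauchy_schwarz)
    also have "\<dots> \<le> norm x * (onorm ((*v) H) * norm x)"
      by (intro mult_left_mono onorm bl) auto
    also have "\<dots> \<le> M * (x \<bullet> x)"
      by (simp add: M_def power2_norm_eq_inner[symmetric] power2_eq_square algebra_simps)
    finally show ?thesis .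
  qed
  let ?M = "M *\<^sub>R mat 1 :: real^'n^'n"
  have sym: "transpose H = H" using assms by (simp add: pd_def)
  have K: "psd (?M - H)"
    using le by (simp add: psd_def transpose_diff transpose_scaleR sym scaleR_matrix_vector_mult
        matrix_vector_mult_diff_rdistrib inner_diff_right)
  \<comment> \<open>Positivity of \<open>?M - K\<close> is a premise inside the induction because it
    passes from the larger downdate back to the smaller one: adding \<open>outer u\<close> again
    preserves it. The sign of the determinant is carried along for the square roots.\<close>
  have "pd (?M - K) \<longrightarrow> det (?M - K) > 0 \<and>
      (\<integral>\<^sup>+x. gaussian (?M - K) x \<partial>lborel) = ennreal ((2 * pi) powr (CARD('n) / 2) / sqrt (det (?M - K)))"
    if "psd K" for K
    using that
  proof (induction K rule: psd_induct)
    case zero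
    have "det ?M = M ^ CARD('n)" by (subst det_diagonal) (auto simp: mat_def)
    moreover have "(2 * pi / M) powr (CARD('n) / 2) = (2 * pi) powr (CARD('n) / 2) / sqrt (M ^ CARD('n))"
      using M by (simp add: powr_divide powr_half_sqrt[symmetric] powr_powr flip: powr_realpow)
    ultimately show ?case using M by (simp add: gaussian_integral_scalar)
  next
    case (outer K u)
    show ?case
    proof
      let ?A = "?M - K"
      assume "pd (?M - (K + outer u))"
      then have pd: "pd (?A - outer u)" by (simp add: algebra_simps)
      from pd_add_psd[OF this psd_outer[of u]] have A: "pd ?A" by simp
      obtain y where y: "?A *v y = u" using A by (rule pd_solve)
      note IH = outer.IH[rule_format, OF A]
      have q: "u \<bullet> y < 1" by (rule pd_minus_outer_solution_less_1[OF pd y])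
      have det: "det (?A - outer u) = det ?A * (1 - u \<bullet> y)"
        using det_plus_outer[OF y, of "-1"] by simp
      have "det (?A - outer u) > 0" using IH q by (simp add: det)
      moreover have "(\<integral>\<^sup>+x. gaussian (?A - outer u) x \<partial>lborel) =
          ennreal ((2 * pi) powr (CARD('n) / 2) / sqrt (det (?A - outer u)))"
        using IH q unfolding gaussian_integral_downdate[OF A pd y] det
        by (simp add: real_sqrt_mult mult.commute flip: ennreal_mult)
      ultimately show "det (?M - (K + outer u)) > 0 \<and> (\<integral>\<^sup>+x. gaussian (?M - (K + outer u)) x \<partial>lborel) =
          ennreal ((2 * pi) powr (CARD('n) / 2) / sqrt (det (?M - (K + outer u))))"
        by (simp add: algebra_simps)
    qed
  qed
  from this[OF K] assms show "det H > 0"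
    "(\<integral>\<^sup>+x. gaussian H x \<partial>lborel) = ennreal ((2 * pi) powr (CARD('n) / 2) / sqrt (det H))"
    by simp_all
qed

text \<open>By the rank-one determinant formula this reduces to
  \<open>u \<bullet> x \<le> u \<bullet> y\<close>, that is, to inversion reversing the order of
  matrices. Nonnegativity of the form of \<open>B\<close> at \<open>x - y\<close> yields it after
  the form of \<open>B\<close> at \<open>x\<close> is enlarged to that of \<open>A\<close>.\<close>

lemma pd_add_outer_det_ratio:
  fixes A B :: "real^'n^'n"
  assumes B: "pd B" and AB: "psd (A - B)"
  shows "det (A + outer u) * det B \<le> det A * det (B + outer u)"
proof -
  have A: "pd A" using pd_add_psd[OF B AB] by simp
  obtain x where x: "A *v x = u" using A by (rule pd_solve)
  obtain y where y: "B *v y = u" using B by (rule pd_solve)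
  have "0 \<le> (x - y) \<bullet> (B *v (x - y))"
    using pd_imp_psd[OF B] by (simp add: psd_def)
  also have "\<dots> = x \<bullet> (B *v x) - 2 * (u \<bullet> x) + u \<bullet> y"
    using symmetric_inner_swap[of B y x] B y
    by (simp add: pd_def matrix_vector_mult_diff_distrib inner_diff_left inner_diff_right inner_commute)
  also have "x \<bullet> (B *v x) \<le> x \<bullet> (A *v x)"
    using AB by (simp add: psd_def matrix_vector_mult_diff_rdistrib inner_diff_right)
  also have "x \<bullet> (A *v x) = u \<bullet> x" by (simp add: x inner_commute)
  finally have "u \<bullet> x \<le> u \<bullet> y" by simp
  moreover have "det (A + outer u) = det A * (1 + u \<bullet> x)" "det (B + outer u) = det B * (1 + u \<bullet> y)"
    using det_plus_outer[OF x, of 1] det_plus_outer[OF y, of 1] by simp_all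
  ultimately show ?thesis
    using gaussian_integral(1)[OF A] gaussian_integral(1)[OF B] by simp
qed

text \<open>Adding the same matrix on both sides leaves \<open>A - B\<close> unchanged, so the
  rank-one comparison applies at every stage of the decomposition of \<open>G\<close>.\<close>

lemma det_ratio_antimono:
  fixes A B :: "real^'n^'n"
  assumes B: "pd B" and AB: "psd (A - B)" and G: "psd G"
  shows "det (A + G) / det (B + G) \<le> det A / det B"
proof -
  have A: "pd A" using pd_add_psd[OF B AB] by simp
  show ?thesis using G
  proof (induction G rule: psd_induct)
    case zero then show ?case by simp
  next
    case (outer G u)
    have pB: "pd (B + G)" "pd (B + G + outer u)"
      using B outer psd_outer by (blast intro: pd_add_psd)+
    have "det (A + G + outer u) * det (B + G) \<le> det (A + G) * det (B + G + outer u)"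
      using AB pB by (intro pd_add_outer_det_ratio) simp_all
    then have "det (A + G + outer u) / det (B + G + outer u) \<le> det (A + G) / det (B + G)"
      using pB[THEN gaussian_integral(1)] by (simp add: field_simps)
    then show ?case using outer.IH by (simp add: add.assoc)
  qed
qed

subsection \<open>Upper smoothness and strong convexity\<close>

lemma upper_smoothE:
  assumes "upper_smooth H c r \<Omega> f" "\<theta> \<in> \<Omega>"
  obtains b where "\<And>\<psi>. f \<psi> - f \<theta> \<le> ereal (c + b \<bullet> (\<psi> - \<theta>) + 1/2 * ((\<psi> - \<theta>) \<bullet> (H *v (\<psi> - \<theta>))))
    + enn2ereal (r ((norm (\<theta> - \<psi>))\<^sup>2))"
  using assms unfolding upper_smooth_def by blast

lemma strongly_convexE:
  assumes "strongly_convex H \<Omega> f" "\<theta> \<in> \<Omega>"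
  obtains b where "\<And>\<psi>. f \<psi> - f \<theta> \<ge> ereal (b \<bullet> (\<psi> - \<theta>) + 1/2 * ((\<psi> - \<theta>) \<bullet> (H *v (\<psi> - \<theta>))))"
  using assms unfolding strongly_convex_def by blast

lemma upper_smooth_remainder:
  assumes "upper_smooth H c r \<Omega> f" "e > 0"
  obtains d where "d > 0" "\<And>s. 0 \<le> s \<Longrightarrow> s < d \<Longrightarrow> r s \<le> ennreal (e * s)"
proof -
  have mono: "mono r" and lim: "((\<lambda>t::real. r (t\<^sup>2) / ennreal (t\<^sup>2)) \<longlongrightarrow> 0) (at 0)"
    using assms(1) by (auto simp: upper_smooth_def)
  have "\<forall>\<^sub>F t in at 0. r (t\<^sup>2) / ennreal (t\<^sup>2) < ennreal e"
    using order_tendstoD(2)[OF lim] assms(2) by simp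
  then obtain d where d: "d > 0" "\<And>t. t \<noteq> 0 \<Longrightarrow> \<bar>t\<bar> < d \<Longrightarrow> r (t\<^sup>2) / ennreal (t\<^sup>2) < ennreal e"
    by (auto simp: eventually_at dist_norm)
  have pos: "r s \<le> ennreal (e * s)" if "0 < s" "s < d\<^sup>2" for s
  proof -
    have "sqrt s < d" using that d(1) by (metis abs_of_pos real_sqrt_abs real_sqrt_less_mono)
    then have "r s / ennreal s < ennreal e" using d(2)[of "sqrt s"] that by simp
    then have "r s / ennreal s * ennreal s \<le> ennreal e * ennreal s"
      by (intro mult_right_mono) auto
    then show ?thesis using that assms(2) by (simp add: ennreal_divide_times ennreal_mult)
  qed
  \<comment> \<open>The limit says nothing at the point 0 itself; monotonicity places
    \<open>r 0\<close> below \<open>r s\<close> for all small positive \<open>s\<close>.\<close>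
  have zero: "r 0 \<le> 0"
  proof (rule ccontr)
    assume "\<not> r 0 \<le> 0"
    then have "r 0 > 0" by (simp add: zero_less_iff_neq_zero)
    moreover have "((\<lambda>s. ennreal (e * s)) \<longlongrightarrow> ennreal (e * 0)) (at_right 0)"
      by (intro tendsto_intros)
    ultimately have "\<forall>\<^sub>F s in at_right 0. ennreal (e * s) < r 0"
      using order_tendstoD(2) by fastforce
    moreover have "\<forall>\<^sub>F s in at_right 0. 0 < s \<and> s < d\<^sup>2"
      using d(1) by (intro eventually_conj eventually_at_right_less eventually_at_rightI[of 0 "d\<^sup>2"]) auto
    ultimately have "\<forall>\<^sub>F s in at_right (0::real). False"
    proof eventually_elim
      case (elim s)
      then have "r 0 \<le> r s" using mono by (simp add: mono_def)
      then show False using elim pos[of s] by auto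
    qed
    then show False by simp
  qed
  show ?thesis
  proof
    show "d\<^sup>2 > 0" using d(1) by simp
    show "r s \<le> ennreal (e * s)" if "0 \<le> s" "s < d\<^sup>2" for s
      using that pos[of s] zero by (cases "s = 0") auto
  qed
qed

lemma upper_smooth_remainder_0: "upper_smooth H c r \<Omega> f \<Longrightarrow> r 0 = 0"
  using upper_smooth_remainder[of H c r \<Omega> f 1] by (metis ennreal_0 le_zero_eq mult_zero_right order.refl zero_less_one)

lemma upper_smooth_not_PInfty:
  assumes "upper_smooth H c r \<Omega> f" "\<theta> \<in> \<Omega>"
  shows "f \<theta> \<noteq> \<infinity>"
proof
  assume inf: "f \<theta> = \<infinity>"
  obtain b where "f \<theta> - f \<theta> \<le> ereal (c + b \<bullet> (\<theta> - \<theta>) + 1/2 * ((\<theta> - \<theta>) \<bullet> (H *v (\<theta> - \<theta>))))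
      + enn2ereal (r ((norm (\<theta> - \<theta>))\<^sup>2))"
    using upper_smoothE[OF assms] by blast
  then show False using inf upper_smooth_remainder_0[OF assms(1)] by (simp add: zero_ennreal.rep_eq)
qed

lemma quadratic_form_scaleR: "(t *\<^sub>R v) \<bullet> (H *v (t *\<^sub>R v)) = t\<^sup>2 * (v \<bullet> (H *v v))" for H :: "real^'n^'n"
  by (simp add: matrix_vector_mult_scaleR power2_eq_square)

text \<open>Averaging the two bounds over \<open>\<theta> + v\<close> and \<open>\<theta> - v\<close> cancels the linear terms.\<close>

lemma upper_smooth_strongly_convex_psd:
  assumes up: "upper_smooth Hu 0 r \<Omega> f" and low: "strongly_convex Hl \<Omega> f"
    and sym: "transpose Hl = Hl" and \<theta>: "\<theta> \<in> \<Omega>" and f: "\<bar>f \<theta>\<bar> \<noteq> \<infinity>"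
  shows "psd (Hu - Hl)"
proof -
  obtain \<xi>u where u: "\<And>\<psi>. f \<psi> - f \<theta> \<le> ereal (0 + \<xi>u \<bullet> (\<psi> - \<theta>) + 1/2 * ((\<psi> - \<theta>) \<bullet> (Hu *v (\<psi> - \<theta>))))
      + enn2ereal (r ((norm (\<theta> - \<psi>))\<^sup>2))"
    using upper_smoothE[OF up \<theta>] by blast
  obtain \<xi>l where l: "\<And>\<psi>. f \<psi> - f \<theta> \<ge> ereal (\<xi>l \<bullet> (\<psi> - \<theta>) + 1/2 * ((\<psi> - \<theta>) \<bullet> (Hl *v (\<psi> - \<theta>))))"
    using strongly_convexE[OF low \<theta>] by blast
  have "v \<bullet> (Hl *v v) \<le> v \<bullet> (Hu *v v) + e" if "e > 0" for v and e :: real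
  proof (cases "v = 0")
    case False
    \<comment> \<open>Both test points will have squared distance \<open>d / 2\<close> from
      \<theta>, within reach of the remainder bound, and \<epsilon> is scaled so that the two
      remainders add up to \<open>t\<^sup>2 * e\<close>.\<close>
    define \<epsilon> where "\<epsilon> = e / (2 * (norm v)\<^sup>2)"
    have "\<epsilon> > 0" using False that by (simp add: \<epsilon>_def)
    then obtain d where d: "d > 0" "\<And>s. 0 \<le> s \<Longrightarrow> s < d \<Longrightarrow> r s \<le> ennreal (\<epsilon> * s)"
      using upper_smooth_remainder[OF up] by blast
    define t where "t = sqrt (d / 2) / norm v"
    have t: "t > 0" "t\<^sup>2 * (norm v)\<^sup>2 = d / 2"
      using d(1) False by (auto simp: t_def power_divide)
    have b: "s * (\<xi>l \<bullet> v) + 1/2 * (t\<^sup>2 * (v \<bullet> (Hl *v v)))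
        \<le> s * (\<xi>u \<bullet> v) + 1/2 * (t\<^sup>2 * (v \<bullet> (Hu *v v))) + \<epsilon> * (d / 2)" if "s\<^sup>2 = t\<^sup>2" for s
    proof -
      have n: "(norm (\<theta> - (\<theta> + s *\<^sub>R v)))\<^sup>2 = d / 2"
        using t that by (simp add: power_mult_distrib)
      have "r (d / 2) \<le> ennreal (\<epsilon> * (d / 2))" using d(2)[of "d / 2"] d(1) by simp
      then have "enn2ereal (r (d / 2)) \<le> enn2ereal (ennreal (\<epsilon> * (d / 2)))"
        by (simp add: less_eq_ennreal.rep_eq)
      also have "\<dots> = ereal (\<epsilon> * (d / 2))"
        using \<open>\<epsilon> > 0\<close> d(1) by (simp add: enn2ereal_ennreal)
      finally have rle: "enn2ereal (r (d / 2)) \<le> ereal (\<epsilon> * (d / 2))" .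
      have "ereal (s * (\<xi>l \<bullet> v) + 1/2 * (t\<^sup>2 * (v \<bullet> (Hl *v v)))) \<le> f (\<theta> + s *\<^sub>R v) - f \<theta>"
        using l[of "\<theta> + s *\<^sub>R v"]
        by (simp only: add_diff_cancel_left' quadratic_form_scaleR inner_scaleR_right that)
      also have "\<dots> \<le> ereal (s * (\<xi>u \<bullet> v) + 1/2 * (t\<^sup>2 * (v \<bullet> (Hu *v v)))) + enn2ereal (r (d / 2))"
        using u[of "\<theta> + s *\<^sub>R v"] unfolding n
        by (simp only: add_diff_cancel_left' quadratic_form_scaleR inner_scaleR_right that add_0)
      also have "\<dots> \<le> ereal (s * (\<xi>u \<bullet> v) + 1/2 * (t\<^sup>2 * (v \<bullet> (Hu *v v)))) + ereal (\<epsilon> * (d / 2))"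
        by (intro add_left_mono rle)
      finally show ?thesis by simp
    qed
    have "t\<^sup>2 * (v \<bullet> (Hl *v v)) \<le> t\<^sup>2 * (v \<bullet> (Hu *v v)) + 2 * \<epsilon> * (d / 2)"
      using b[of t] b[of "- t"] by (simp add: field_simps)
    also have "2 * \<epsilon> * (d / 2) = t\<^sup>2 * e"
      using False by (simp add: \<epsilon>_def flip: t(2))
    finally have "t\<^sup>2 * (v \<bullet> (Hl *v v)) \<le> t\<^sup>2 * (v \<bullet> (Hu *v v) + e)" by (simp add: algebra_simps)
    then show ?thesis using t(1) by simp
  qed (use that in simp)
  then have "v \<bullet> (Hl *v v) \<le> v \<bullet> (Hu *v v)" for v by (rule field_le_epsilon)
  moreover have "transpose Hu = Hu" using up by (simp add: upper_smooth_def psd_def)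
  ultimately show ?thesis
    by (simp add: psd_def sym transpose_diff matrix_vector_mult_diff_rdistrib inner_diff_right)
qed

text \<open>With equal curvature on both sides only the linear terms can differ; their inequality in
  every direction \<open>v\<close> also holds for \<open>- v\<close>, so they agree. The two bounds
  then pin \<open>g\<close> down as a quadratic polynomial, finite everywhere.\<close>

lemma quadratic_penaltyE:
  assumes up: "upper_smooth H 0 (\<lambda>_. 0) \<Omega> g" and low: "strongly_convex H \<Omega> g"
    and \<theta>: "\<theta> \<in> \<Omega>" and g: "g \<theta> \<noteq> -\<infinity>"
  obtains a b where "\<And>\<psi>. g \<psi> = ereal (a + b \<bullet> (\<psi> - \<theta>) + 1/2 * ((\<psi> - \<theta>) \<bullet> (H *v (\<psi> - \<theta>))))"
proof -
  obtain a where a: "g \<theta> = ereal a"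
    using g upper_smooth_not_PInfty[OF up \<theta>] by (cases "g \<theta>") auto
  obtain \<xi>u where u: "\<And>\<psi>. g \<psi> - g \<theta> \<le> ereal (\<xi>u \<bullet> (\<psi> - \<theta>) + 1/2 * ((\<psi> - \<theta>) \<bullet> (H *v (\<psi> - \<theta>))))"
  proof -
    obtain b where "\<And>\<psi>. g \<psi> - g \<theta> \<le> ereal (0 + b \<bullet> (\<psi> - \<theta>) + 1/2 * ((\<psi> - \<theta>) \<bullet> (H *v (\<psi> - \<theta>)))) + enn2ereal 0"
      using upper_smoothE[OF up \<theta>] by blast
    then show thesis by (intro that[of b]) (simp add: zero_ennreal.rep_eq)
  qed
  obtain \<xi>l where l: "\<And>\<psi>. g \<psi> - g \<theta> \<ge> ereal (\<xi>l \<bullet> (\<psi> - \<theta>) + 1/2 * ((\<psi> - \<theta>) \<bullet> (H *v (\<psi> - \<theta>))))"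
    using strongly_convexE[OF low \<theta>] by blast
  have le: "\<xi>l \<bullet> v \<le> \<xi>u \<bullet> v" for v
    using order.trans[OF l u, of "\<theta> + v"] by simp
  have eq: "\<xi>l \<bullet> v = \<xi>u \<bullet> v" for v
    using le[of v] le[of "- v"] by simp
  have "g \<psi> = ereal (a + \<xi>u \<bullet> (\<psi> - \<theta>) + 1/2 * ((\<psi> - \<theta>) \<bullet> (H *v (\<psi> - \<theta>))))" for \<psi>
    using u[of \<psi>] l[of \<psi>] by (cases "g \<psi>") (auto simp: a eq)
  then show thesis by (rule that)
qed

section \<open>Weighted penalties and growth away from an interior minimizer\<close>

lemma penalty_ereal:
  assumes "\<And>j. g j \<theta> = ereal (\<gamma> j \<theta>)"
  shows "penalty g \<theta> l = ereal (\<Sum>j\<in>UNIV. l $ j * \<gamma> j \<theta>)"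
  by (simp add: penalty_def assms)

lemma sum_matrix_vector_mult: "(\<Sum>j\<in>S. F j) *v v = (\<Sum>j\<in>S. F j *v v)" for v :: "real^'n"
  by (induction S rule: infinite_finite_induct) (auto simp: matrix_vector_mult_add_rdistrib)

lemma strongly_convex_plus_penalty:
  assumes f: "strongly_convex H0 \<Omega> f" "\<And>\<psi>. f \<psi> \<noteq> -\<infinity>"
    and g: "\<And>j. strongly_convex (H j) \<Omega> (g j)" "\<And>j \<psi>. g j \<psi> = ereal (\<gamma> j \<psi>)"
    and l: "\<And>j. 0 \<le> l $ j"
  shows "strongly_convex (H_comb H0 H l) \<Omega> (\<lambda>\<theta>. f \<theta> + penalty g \<theta> l)"
proof -
  obtain \<xi> where \<xi>: "\<And>\<psi> \<theta>. \<theta> \<in> \<Omega> \<Longrightarrow>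
      f \<psi> - f \<theta> \<ge> ereal (\<xi> \<theta> \<bullet> (\<psi> - \<theta>) + 1/2 * ((\<psi> - \<theta>) \<bullet> (H0 *v (\<psi> - \<theta>))))"
    using f(1) unfolding strongly_convex_def by blast
  have "\<forall>j. \<exists>\<zeta>. \<forall>\<psi>. \<forall>\<theta>\<in>\<Omega>. \<gamma> j \<psi> - \<gamma> j \<theta> \<ge> \<zeta> \<theta> \<bullet> (\<psi> - \<theta>) + 1/2 * ((\<psi> - \<theta>) \<bullet> (H j *v (\<psi> - \<theta>)))"
    using g(1) unfolding strongly_convex_def g(2) by simp
  then obtain \<zeta> where \<zeta>: "\<And>j \<psi> \<theta>. \<theta> \<in> \<Omega> \<Longrightarrow>
      \<gamma> j \<psi> - \<gamma> j \<theta> \<ge> \<zeta> j \<theta> \<bullet> (\<psi> - \<theta>) + 1/2 * ((\<psi> - \<theta>) \<bullet> (H j *v (\<psi> - \<theta>)))"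
    by metis
  define P where "P \<theta> = (\<Sum>j\<in>UNIV. l $ j * \<gamma> j \<theta>)" for \<theta>
  have pen: "penalty g \<theta> l = ereal (P \<theta>)" for \<theta>
    using g(2) by (simp add: penalty_ereal P_def)
  show ?thesis
    unfolding strongly_convex_def pen
  proof (intro exI[of _ "\<lambda>\<theta>. \<xi> \<theta> + (\<Sum>j\<in>UNIV. l $ j *\<^sub>R \<zeta> j \<theta>)"] allI ballI)
    fix \<psi> \<theta> assume \<theta>: "\<theta> \<in> \<Omega>"
    let ?v = "\<psi> - \<theta>"
    define q where "q = (\<Sum>j\<in>UNIV. l $ j * (\<zeta> j \<theta> \<bullet> ?v + 1/2 * (?v \<bullet> (H j *v ?v))))"
    have "q \<le> (\<Sum>j\<in>UNIV. l $ j * (\<gamma> j \<psi> - \<gamma> j \<theta>))"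
      unfolding q_def by (intro sum_mono mult_left_mono l \<zeta> \<theta>)
    then have q: "q \<le> P \<psi> - P \<theta>" by (simp add: P_def right_diff_distrib sum_subtractf)
    have "(\<xi> \<theta> + (\<Sum>j\<in>UNIV. l $ j *\<^sub>R \<zeta> j \<theta>)) \<bullet> ?v + 1/2 * (?v \<bullet> (H_comb H0 H l *v ?v)) =
        (\<xi> \<theta> \<bullet> ?v + 1/2 * (?v \<bullet> (H0 *v ?v))) + q"
      by (simp add: q_def H_comb_def matrix_vector_mult_add_rdistrib sum_matrix_vector_mult scaleR_matrix_vector_mult
          inner_add_left inner_add_right inner_sum_left inner_sum_right distrib_left sum.distrib
          sum_divide_distrib sum_distrib_left)
    \<comment> \<open>If \<open>f \<psi>\<close> is infinite, so is the right side, even when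
      \<open>f \<theta>\<close> is infinite too; a finite \<open>f \<psi>\<close> with infinite
      \<open>f \<theta>\<close> contradicts strong convexity.\<close>
    moreover have "ereal ((\<xi> \<theta> \<bullet> ?v + 1/2 * (?v \<bullet> (H0 *v ?v))) + q) \<le> f \<psi> + ereal (P \<psi>) - (f \<theta> + ereal (P \<theta>))"
      using \<xi>[OF \<theta>, of \<psi>] q f(2) by (cases "f \<psi>"; cases "f \<theta>") (auto simp: field_simps)
    ultimately show "ereal ((\<xi> \<theta> + (\<Sum>j\<in>UNIV. l $ j *\<^sub>R \<zeta> j \<theta>)) \<bullet> ?v + 1/2 * (?v \<bullet> (H_comb H0 H l *v ?v)))
        \<le> f \<psi> + ereal (P \<psi>) - (f \<theta> + ereal (P \<theta>))" by simp
  qed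
qed

text \<open>\<open>h\<close> need not be differentiable at \<open>\<theta>\<close>, so its subgradient there may be nonzero. Instead, apply strong
  convexity at points of the segment from \<open>\<theta>\<close> to \<open>\<psi>\<close> close to \<open>\<theta>\<close>.\<close>

lemma strongly_convex_growth:
  assumes sc: "strongly_convex H \<Omega> h" and int: "\<theta> \<in> interior \<Omega>"
    and fin: "\<And>\<theta>. \<theta> \<in> \<Omega> \<Longrightarrow> \<bar>h \<theta>\<bar> \<noteq> \<infinity>" and h: "h \<psi> \<noteq> -\<infinity>"
    and min: "\<And>\<theta>'. \<theta>' \<in> \<Omega> \<Longrightarrow> h \<theta> \<le> h \<theta>'"
  shows "h \<theta> + ereal (1/2 * ((\<psi> - \<theta>) \<bullet> (H *v (\<psi> - \<theta>)))) \<le> h \<psi>"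
proof (cases "h \<psi>")
  case (real b)
  have \<theta>: "\<theta> \<in> \<Omega>" using int interior_subset by blast
  obtain a where a: "h \<theta> = ereal a" using fin[OF \<theta>] by auto
  obtain \<xi> where \<xi>: "\<And>\<psi> \<theta>. \<theta> \<in> \<Omega> \<Longrightarrow>
      h \<psi> - h \<theta> \<ge> ereal (\<xi> \<theta> \<bullet> (\<psi> - \<theta>) + 1/2 * ((\<psi> - \<theta>) \<bullet> (H *v (\<psi> - \<theta>))))"
    using sc unfolding strongly_convex_def by blast
  define d where "d = \<psi> - \<theta>"
  define q where "q = 1/2 * (d \<bullet> (H *v d))"
  have bound: "q * (1 - t) \<le> b - a" if t: "0 < t" "t < 1" "\<theta> + t *\<^sub>R d \<in> \<Omega>" for t
  proof -
    let ?x = "\<theta> + t *\<^sub>R d"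
    define k where "k = \<xi> ?x \<bullet> d"
    obtain m where m: "h ?x = ereal m" using fin[OF t(3)] by auto
    have d1: "\<psi> - ?x = (1 - t) *\<^sub>R d" and d2: "\<theta> - ?x = (- t) *\<^sub>R d"
      by (simp_all add: d_def algebra_simps)
    have 1: "(1 - t) * k + (1 - t)\<^sup>2 * q \<le> b - m"
      using \<xi>[OF t(3), of \<psi>] unfolding d1 quadratic_form_scaleR by (simp add: m real k_def q_def)
    have 2: "- t * k + t\<^sup>2 * q \<le> a - m"
      using \<xi>[OF t(3), of \<theta>] unfolding d2 quadratic_form_scaleR by (simp add: m a k_def q_def)
    \<comment> \<open>The weights \<open>t\<close> and \<open>1 - t\<close> cancel the subgradient
      term \<open>k\<close>, and the curvature terms add up to \<open>t * (1 - t) * q\<close>.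
      Minimality then enters as \<open>a \<le> m\<close>.\<close>
    have "t * (q * (1 - t)) = t * ((1 - t) * k + (1 - t)\<^sup>2 * q) + (1 - t) * (- t * k + t\<^sup>2 * q)"
      by (simp add: power2_eq_square algebra_simps)
    also have "\<dots> \<le> t * (b - m) + (1 - t) * (a - m)"
      using 1 2 t by (intro add_mono mult_left_mono) auto
    also have "\<dots> \<le> t * (b - a)"
      using min[OF t(3)] by (simp add: a m algebra_simps)
    finally show ?thesis using t(1) by simp
  qed
  \<comment> \<open>Interiority enters here: \<psi> may lie outside \<Omega>, but the segment
    towards it stays in \<Omega> for small \<open>t\<close>.\<close>
  have "((\<lambda>t. \<theta> + t *\<^sub>R d) \<longlongrightarrow> \<theta> + 0 *\<^sub>R d) (at_right 0)"
    by (intro tendsto_intros)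
  then have "\<forall>\<^sub>F t in at_right 0. \<theta> + t *\<^sub>R d \<in> interior \<Omega>"
    using int by (auto dest: topological_tendstoD)
  moreover have "\<forall>\<^sub>F t in at_right 0. 0 < t \<and> t < (1::real)"
    by (intro eventually_conj eventually_at_right_less eventually_at_rightI[of 0 1]) auto
  ultimately have "\<forall>\<^sub>F t in at_right 0. q * (1 - t) \<le> b - a"
    by eventually_elim (use bound interior_subset in blast)
  moreover have "((\<lambda>t. q * (1 - t)) \<longlongrightarrow> q * (1 - 0)) (at_right 0)"
    by (intro tendsto_intros)
  ultimately have "q \<le> b - a"
    using tendsto_upperbound[of "\<lambda>t. q * (1 - t)" "q * (1 - 0)" "at_right 0" "b - a"] by simp
  then show ?thesis by (simp add: a real q_def d_def)
qed (use h in auto)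

subsection \<open>Normalizers\<close>

text \<open>By Markov's inequality the sets where \<open>u\<close> is at least \<open>1 / n\<close>
  have finite measure, and they exhaust the space because \<open>u\<close> is positive.\<close>

lemma sigma_finite_if_positive_integrable:
  assumes u: "u \<in> borel_measurable M" "(\<integral>\<^sup>+x. u x \<partial>M) \<noteq> \<infinity>" "\<And>x. x \<in> space M \<Longrightarrow> u x > 0"
  shows "sigma_finite_measure M"
proof -
  let ?A = "\<lambda>n::nat. {x \<in> space M. 1 \<le> of_nat n * u x}"
  show ?thesis
  proof (intro sigma_finite_measure.intro exI[of _ "range ?A"] conjI ballI)
    show "range ?A \<subseteq> sets M" using u(1) by auto
    show "\<Union> (range ?A) = space M"
    proof (intro equalityI subsetI)
      fix x assume x: "x \<in> space M"
      have "\<exists>n. 1 \<le> of_nat n * u x"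
      proof (cases "u x")
        case (real y)
        then have "y > 0" using u(3)[OF x] by simp
        then obtain n :: nat where "1 / y \<le> real n" using real_arch_simple by blast
        then have "1 \<le> real n * y" using \<open>y > 0\<close> by (simp add: field_simps)
        then have "1 \<le> of_nat n * u x"
          using real by (metis ennreal_1 ennreal_leI ennreal_mult ennreal_of_nat_eq_real_of_nat of_nat_0_le_iff)
        then show ?thesis by blast
      next
        case top
        then show ?thesis by (intro exI[of _ 1]) simp
      qed
      then show "x \<in> \<Union> (range ?A)" using x by auto
    qed auto
    fix a assume "a \<in> range ?A"
    then obtain n where a: "a = ?A n" by blast
    have "emeasure M (?A n) \<le> of_nat n * (\<integral>\<^sup>+x. u x * indicator (space M) x \<partial>M)"
      using nn_integral_Markov_inequality[of u "space M" M "of_nat n"] u(1) by simp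
    also have "\<dots> = of_nat n * (\<integral>\<^sup>+x. u x \<partial>M)"
      by (intro arg_cong2[where f = "(*)"] nn_integral_cong) auto
    also have "\<dots> < \<infinity>" using u(2) by (simp add: ennreal_mult_less_top top.not_eq_extremum of_nat_less_top)
    finally show "emeasure M a \<noteq> \<infinity>" using a by simp
  qed auto
qed

lemma sigma_finite_lebesgue: "sigma_finite_measure (lebesgue :: 'a::euclidean_space measure)"
proof -
  obtain A :: "'a set set" where "countable A" "A \<subseteq> sets lborel" "\<Union> A = space lborel" "\<forall>a\<in>A. emeasure lborel a \<noteq> \<infinity>"
    using lborel.sigma_finite_countable by blast
  then show ?thesis
    by (intro sigma_finite_measure.intro exI[of _ A]) (auto simp: subset_iff)
qed

section \<open>The extended exponential and the exchange of integrals\<close>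

lemma eexp_simps [simp]:
  "eexp (ereal y) = ennreal (exp y)" "eexp \<infinity> = \<infinity>" "eexp (-\<infinity>) = 0"
  by (simp_all only: eexp_def infinity_ereal_def uminus_ereal.simps ereal.case)

lemma eexp_mono: "x \<le> y \<Longrightarrow> eexp x \<le> eexp y"
  by (cases x; cases y) auto

lemma eexp_measurable [measurable]: "eexp \<in> borel_measurable borel"
proof -
  have "eexp = (\<lambda>x. if x = \<infinity> then \<infinity> else if x = -\<infinity> then 0 else ennreal (exp (real_of_ereal x)))"
    by (intro ext) (metis eexp_simps ereal_cases real_of_ereal.simps(1) PInfty_neq_ereal(1) MInfty_neq_ereal(1))
  then show ?thesis by (rule ssubst) measurable
qed

lemma eexp_minus_minus_ereal: "eexp (- x - ereal y) = eexp (- x) * ennreal (exp (- y))"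
  by (cases x) (auto simp: ennreal_mult ennreal_top_mult exp_minus exp_diff divide_inverse)

lemma gaussian_integral_shift:
  "(\<integral>\<^sup>+x. gaussian H (x - t) \<partial>lebesgue) = (\<integral>\<^sup>+x. gaussian H x \<partial>lborel)"
  using nn_integral_lborel_shift[of "gaussian H" "- t"]
  by (subst nn_integral_completion) (simp_all add: algebra_simps)

text \<open>Both factors on the left combine into one double integral over \<open>E\<close> and
  \<open>W\<close>. Integrating over \<psi> first, translation invariance removes the centre
  \<open>t X\<close>, and only \<open>m X\<close> times the Gaussian integral remains.\<close>

lemma mass_times_penalty_integral_le:
  fixes f :: "'x \<Rightarrow> real^'p \<Rightarrow> ereal" and P :: "real^'p \<Rightarrow> real"
  assumes \<nu>: "sigma_finite_measure \<nu>"
    and f [measurable]: "(\<lambda>(X, \<theta>). f X \<theta>) \<in> borel_measurable (\<nu> \<Otimes>\<^sub>M lebesgue)"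
    and E [measurable]: "E \<in> sets \<nu>" and W [measurable]: "W \<in> sets lebesgue"
    and P [measurable]: "P \<in> borel_measurable borel" and H: "pd H"
    and bound: "\<And>X \<psi>. X \<in> E \<Longrightarrow> eexp (- f X \<psi> - ereal (P \<psi>)) \<le> m X * gaussian H (\<psi> - t X)"
  shows "(INF \<psi>\<in>W. \<integral>\<^sup>+X\<in>E. eexp (- f X \<psi>) \<partial>\<nu>) * (\<integral>\<^sup>+\<psi>\<in>W. ennreal (exp (- P \<psi>)) \<partial>lebesgue)
    \<le> (\<integral>\<^sup>+x. gaussian H x \<partial>lborel) * (\<integral>\<^sup>+X. m X \<partial>\<nu>)"
proof -
  interpret N: sigma_finite_measure \<nu> by (rule \<nu>)
  interpret L: sigma_finite_measure "lebesgue :: (real^'p) measure" by (rule sigma_finite_lebesgue)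
  interpret pair_sigma_finite \<nu> "lebesgue :: (real^'p) measure" ..
  have [measurable]: "P \<in> borel_measurable lebesgue"
    using measurable_completion[of P lborel borel] P by simp
  define T where "T \<psi> = (\<integral>\<^sup>+X\<in>E. eexp (- f X \<psi>) \<partial>\<nu>)" for \<psi>
  define k where "k = (INF \<psi>\<in>W. T \<psi>)"
  define e where "e \<psi> = ennreal (exp (- P \<psi>)) * indicator W \<psi>" for \<psi>
  have [measurable]: "e \<in> borel_measurable lebesgue" unfolding e_def by measurable
  define F where "F X \<psi> = eexp (- f X \<psi>) * indicator E X * e \<psi>" for X \<psi>
  have F [measurable]: "case_prod F \<in> borel_measurable (\<nu> \<Otimes>\<^sub>M lebesgue)"
    unfolding F_def by measurable
  define G where "G X = (\<integral>\<^sup>+\<psi>. F X \<psi> \<partial>lebesgue)" for X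
  have G [measurable]: "G \<in> borel_measurable \<nu>"
    unfolding G_def using F by (intro L.borel_measurable_nn_integral) auto
  define \<kappa> where "\<kappa> = (2 * pi) powr (CARD('p) / 2) / sqrt (det H)"
  have \<kappa>: "\<kappa> > 0" "(\<integral>\<^sup>+x. gaussian H x \<partial>lborel) = ennreal \<kappa>"
    using gaussian_integral[OF H] by (simp_all add: \<kappa>_def)
  have f_section: "(\<lambda>X. eexp (- f X \<psi>) * indicator E X) \<in> borel_measurable \<nu>" for \<psi>
  proof -
    have "(\<lambda>X. (\<lambda>(X, \<theta>). f X \<theta>) (X, \<psi>)) \<in> borel_measurable \<nu>"
      by (rule measurable_compose[OF measurable_Pair2' f]) simp
    then have [measurable]: "(\<lambda>X. f X \<psi>) \<in> borel_measurable \<nu>" by simp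
    show ?thesis by measurable
  qed
  have "k * (\<integral>\<^sup>+\<psi>. e \<psi> \<partial>lebesgue) = (\<integral>\<^sup>+\<psi>. k * e \<psi> \<partial>lebesgue)"
    by (simp add: nn_integral_cmult)
  also have "\<dots> \<le> (\<integral>\<^sup>+\<psi>. (\<integral>\<^sup>+X. F X \<psi> \<partial>\<nu>) \<partial>lebesgue)"
  proof (rule nn_integral_mono)
    fix \<psi>
    have "k * e \<psi> \<le> T \<psi> * e \<psi>"
      by (cases "\<psi> \<in> W") (auto simp: k_def e_def intro!: mult_right_mono INF_lower)
    also have "\<dots> = (\<integral>\<^sup>+X. F X \<psi> \<partial>\<nu>)"
      unfolding T_def F_def using f_section by (simp add: nn_integral_multc)
    finally show "k * e \<psi> \<le> (\<integral>\<^sup>+X. F X \<psi> \<partial>\<nu>)" .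
  qed
  also have "\<dots> = (\<integral>\<^sup>+X. G X \<partial>\<nu>)"
    unfolding G_def using Fubini[OF F] by simp
  \<comment> \<open>Nothing is known about measurability of \<open>m\<close>, a supremum over
    \<Omega> in the application. The constant is therefore pulled out of the measurable
    \<open>G\<close>, and \<open>m\<close> is compared by monotonicity alone.\<close>
  also have "\<dots> = (\<integral>\<^sup>+X. ennreal \<kappa> * (ennreal (1 / \<kappa>) * G X) \<partial>\<nu>)"
    using \<kappa>(1) by (simp flip: mult.assoc ennreal_mult)
  also have "\<dots> = ennreal \<kappa> * (\<integral>\<^sup>+X. ennreal (1 / \<kappa>) * G X \<partial>\<nu>)"
    by (rule nn_integral_cmult) simp
  also have "\<dots> \<le> ennreal \<kappa> * (\<integral>\<^sup>+X. m X \<partial>\<nu>)"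
  proof (intro mult_left_mono nn_integral_mono)
    fix X
    have "G X \<le> ennreal \<kappa> * m X"
    proof (cases "X \<in> E")
      case True
      have "G X \<le> (\<integral>\<^sup>+\<psi>. m X * gaussian H (\<psi> - t X) \<partial>lebesgue)"
        unfolding G_def
      proof (rule nn_integral_mono)
        fix \<psi>
        have "F X \<psi> \<le> eexp (- f X \<psi> - ereal (P \<psi>))"
          by (auto simp: F_def e_def eexp_minus_minus_ereal indicator_def)
        also have "\<dots> \<le> m X * gaussian H (\<psi> - t X)" using bound True .
        finally show "F X \<psi> \<le> m X * gaussian H (\<psi> - t X)" .
      qed
      also have "\<dots> = m X * ennreal \<kappa>"
        unfolding \<kappa>(2)[symmetric] gaussian_integral_shift[of H "t X", symmetric]
        by (intro nn_integral_cmult measurable_completion) measurable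
      finally show ?thesis by (simp add: mult.commute)
    qed (simp add: G_def F_def)
    then have "ennreal (1 / \<kappa>) * G X \<le> ennreal (1 / \<kappa>) * (ennreal \<kappa> * m X)"
      by (rule mult_left_mono) simp
    also have "\<dots> = m X" using \<kappa>(1) by (simp flip: mult.assoc ennreal_mult)
    finally show "ennreal (1 / \<kappa>) * G X \<le> m X" .
  qed simp
  finally show ?thesis by (simp add: k_def T_def e_def \<kappa>(2))
qed

section \<open>Extended logarithms\<close>

lemma elog_0 [simp]: "elog 0 = -\<infinity>" and elog_top [simp]: "elog top = \<infinity>"
  by (simp_all add: elog_def)

lemma elog_ennreal: "0 < x \<Longrightarrow> elog (ennreal x) = ereal (ln x)"
  by (simp add: elog_def)

lemma elog_eq_PInfty_iff: "elog x = \<infinity> \<longleftrightarrow> x = \<infinity>"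
  by (simp add: elog_def)

lemma elog_bound:
  assumes le: "k * I \<le> ennreal \<kappa> * Z" and fin: "R \<noteq> \<infinity>" "k \<noteq> \<infinity>"
    and pos: "0 < a" "0 < w" "0 < \<kappa>" and C: "a * \<kappa> / w \<le> exp C"
  shows "elog (ennreal a / (ennreal w * R) * I) \<le> elog Z + (ereal C - elog R - elog k)"
proof -
  \<comment> \<open>In the first case one summand on the right is \<infinity>, and ereal addition
    lets it win even over an \<open>elog Z\<close> of -\<infinity>. In the second,
    \<open>k > 0\<close> and finite \<open>Z\<close> force \<open>I\<close> to be finite.\<close>
  consider "R = 0 \<or> k = 0 \<or> Z = \<infinity>" | "R \<noteq> 0" "k \<noteq> 0" "Z \<noteq> \<infinity>" by blast
  then show ?thesis
  proof cases
    case 1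
    have "elog R \<noteq> \<infinity>" "elog k \<noteq> \<infinity>" using fin by (simp_all add: elog_eq_PInfty_iff)
    then have inf: "elog Z + (ereal C - elog R - elog k) = \<infinity>"
      using 1 by (cases "elog R"; cases "elog k") auto
    show ?thesis unfolding inf by simp
  next
    case 2
    obtain \<rho> where \<rho>: "R = ennreal \<rho>" "\<rho> > 0" using 2 fin by (cases R) (auto simp: less_le)
    obtain \<tau> where \<tau>: "k = ennreal \<tau>" "\<tau> > 0" using 2 fin by (cases k) (auto simp: less_le)
    obtain z where z: "Z = ennreal z" "z \<ge> 0" using 2 by (cases Z) auto
    have le': "ennreal \<tau> * I \<le> ennreal (\<kappa> * z)"
      using le pos z by (simp add: \<tau>(1) ennreal_mult)
    have "I \<noteq> \<infinity>"
    proof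
      assume "I = \<infinity>"
      then show False using le' \<tau>(2) by (simp add: ennreal_mult_top top_unique)
    qed
    then obtain i where i: "I = ennreal i" "i \<ge> 0" by (cases I) auto
    have iz: "\<tau> * i \<le> \<kappa> * z" using le' \<tau>(2) i pos z by (simp flip: ennreal_mult)
    have lhs: "ennreal a / (ennreal w * R) * I = ennreal (a / (w * \<rho>) * i)"
      using pos i \<rho> by (simp add: divide_ennreal flip: ennreal_mult)
    show ?thesis
    proof (cases "i = 0")
      case True
      then show ?thesis unfolding lhs by simp
    next
      case False
      then have ip: "i > 0" using i by simp
      then have "0 < \<kappa> * z" using iz \<tau>(2) by (smt (verit) mult_pos_pos)
      then have zp: "z > 0" using pos by (simp add: zero_less_mult_iff)
      have "a / (w * \<rho>) * i \<le> a / (w * \<rho>) * (\<kappa> * z / \<tau>)"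
        using iz \<tau> \<rho> pos by (intro mult_left_mono) (auto simp: field_simps)
      also have "\<dots> = (a * \<kappa> / w) * (z / (\<rho> * \<tau>))" by simp
      also have "\<dots> \<le> exp C * (z / (\<rho> * \<tau>))"
        using C zp \<rho> \<tau> by (intro mult_right_mono) auto
      finally have "ln (a / (w * \<rho>) * i) \<le> ln (exp C * (z / (\<rho> * \<tau>)))"
        using pos \<rho> ip by (subst ln_le_cancel_iff) (auto intro!: mult_pos_pos divide_pos_pos zp \<tau>)
      also have "\<dots> = ln z + (C - ln \<rho> - ln \<tau>)"
        using zp \<rho> \<tau> by (simp add: ln_mult ln_div)
      finally show ?thesis
        using pos \<rho> \<tau> ip zp unfolding lhs by (simp add: \<rho>(1) \<tau>(1) z(1) elog_ennreal)
    qed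
  qed
qed

section \<open>Inverse covariance and finiteness of the Gaussian expectation\<close>

lemma matrix_inv_inverse:
  fixes A :: "real^'n^'n"
  assumes "invertible A"
  shows "A ** matrix_inv A = mat 1" and "matrix_inv A ** A = mat 1"
  using someI_ex[OF assms[unfolded invertible_def]] by (auto simp: matrix_inv_def)

text \<open>\<open>R_factor\<close> passes the covariance \<open>matrix_inv H\<close> to the normal
  density, which inverts it once more; this brings back \<open>H\<close>.\<close>

lemma matrix_inv_matrix_inv:
  fixes A :: "real^'n^'n"
  assumes "invertible A"
  shows "matrix_inv (matrix_inv A) = A"
proof -
  have "invertible (matrix_inv A)"
    using matrix_inv_inverse[OF assms] by (auto simp: invertible_def)
  then have "matrix_inv (matrix_inv A) = (A ** matrix_inv A) ** matrix_inv (matrix_inv A)"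
    by (simp add: matrix_inv_inverse(1)[OF assms])
  also have "\<dots> = A"
    using matrix_inv_inverse(1)[OF \<open>invertible (matrix_inv A)\<close>] by (simp flip: matrix_mul_assoc)
  finally show ?thesis .
qed

text \<open>The integrand is at most 1, so the total Gaussian mass is a bound. Finiteness suffices,
  so the normalizing constant \<open>n\<close> is never evaluated.\<close>

lemma R_factor_finite:
  fixes H :: "real^'p^'p"
  assumes H: "pd H"
  shows "R_factor r H U \<noteq> \<infinity>"
proof -
  have inv: "invertible H"
    using gaussian_integral(1)[OF H] by (simp add: invertible_det_nz)
  have HH: "matrix_inv (matrix_inv H) = H"
    using inv by (rule matrix_inv_matrix_inv)
  let ?N = "centered_normal (matrix_inv H)"
  define n where "n = 1 / sqrt ((2 * pi) ^ CARD('p) * det (matrix_inv H))"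
  have "R_factor r H U \<le> (\<integral>\<^sup>+z. 1 \<partial>?N)"
    unfolding R_factor_def
  proof (rule nn_integral_mono)
    fix z :: "real^'p"
    have "eexp (- enn2ereal (r ((norm z)\<^sup>2))) \<le> eexp (ereal 0)"
      by (rule eexp_mono) (simp add: enn2ereal_nonneg flip: zero_ereal_def)
    then show "indicator U z * eexp (- enn2ereal (r ((norm z)\<^sup>2))) \<le> 1"
      by (auto simp: indicator_def)
  qed
  also have "\<dots> = (\<integral>\<^sup>+z. ennreal (exp (- (z \<bullet> (H *v z)) / 2) * n) \<partial>lebesgue)"
    unfolding centered_normal_def HH n_def
    by (subst nn_integral_density) (auto intro!: measurable_completion)
  also have "\<dots> \<le> (\<integral>\<^sup>+z. gaussian H z * ennreal n \<partial>lebesgue)"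
    by (intro nn_integral_mono) (simp add: gaussian_def ennreal_mult')
  also have "\<dots> = (\<integral>\<^sup>+z. gaussian H z \<partial>lebesgue) * ennreal n"
    by (intro nn_integral_multc measurable_completion) measurable
  also have "\<dots> < \<infinity>"
    using gaussian_integral_shift[of H 0] gaussian_integral(2)[OF H] by (simp add: ennreal_mult_less_top)
  finally show ?thesis by simp
qed

theorem theorem3:
  fixes \<nu> :: "'x measure"
    and f :: "'x \<Rightarrow> real^'p \<Rightarrow> ereal"
    and g :: "'d::finite \<Rightarrow> real^'p \<Rightarrow> ereal"
    and \<Omega>\<^sub>0 \<Omega> U :: "(real^'p) set"
    and A :: "(real^'d) set"
    and \<theta>hat :: "'x \<Rightarrow> real^'d \<Rightarrow> real^'p"
    and Hup0 Hlow0 :: "real^'p^'p"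
    and Hup Hlow :: "'d \<Rightarrow> real^'p^'p"
    and c0 :: real and c :: "'d \<Rightarrow> real" and r :: "real \<Rightarrow> ennreal"
  (* Inf A is the coordinatewise infimum *)
  assumes f_values: "\<forall>X\<in>space \<nu>. \<forall>\<theta>. f X \<theta> \<noteq> -\<infinity>"
    and f_measurable: "(\<lambda>(X, \<theta>). f X \<theta>) \<in> borel_measurable (\<nu> \<Otimes>\<^sub>M lebesgue)"
    and closed_\<Omega>0: "closed \<Omega>\<^sub>0"
    and log_loss: "\<forall>\<theta>\<in>\<Omega>\<^sub>0. (\<integral>\<^sup>+X. eexp (- f X \<theta>) \<partial>\<nu>) = 1"
    and \<Omega>_subset: "\<Omega> \<subseteq> \<Omega>\<^sub>0"
    and g_values: "\<forall>j \<theta>. g j \<theta> \<noteq> -\<infinity>"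
    and A_convex: "convex A"
    and A_nonneg: "\<forall>l\<in>A. \<forall>j. 0 \<le> l $ j"
    and minimizer: "\<forall>X\<in>space \<nu>. \<forall>l\<in>insert (Inf A) A.
          is_arg_min (\<lambda>\<theta>. f X \<theta> + penalty g \<theta> l) (\<lambda>\<theta>. \<theta> \<in> \<Omega>) (\<theta>hat X l)"
    and regular_penalty: "\<forall>X\<in>space \<nu>. \<forall>l\<in>insert (Inf A) A. \<forall>l'\<in>insert (Inf A) A.
          l \<le> l' \<longrightarrow> \<theta>hat X l \<in> interior \<Omega> \<longrightarrow> \<theta>hat X l' \<in> interior \<Omega>"
    and interior_measurable: "{X \<in> space \<nu>. \<theta>hat X (Inf A) \<in> interior \<Omega>} \<in> sets \<nu>"
    and f_upper: "\<forall>X\<in>space \<nu>. upper_smooth Hup0 c0 r \<Omega> (f X)"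
    and Hup0_pd: "pd Hup0"
    and g_upper: "\<forall>j. upper_smooth (Hup j) (c j) (\<lambda>_. 0) \<Omega> (g j)"
    and f_convex: "\<forall>X\<in>space \<nu>. strongly_convex Hlow0 \<Omega> (f X)"
    and Hlow0_pd: "pd Hlow0"
    and g_convex: "\<forall>j. strongly_convex (Hlow j) \<Omega> (g j)"
    and Hlow_psd: "\<forall>j. psd (Hlow j)"
  (* compatibility of the two curvature matrices; automatic when c0 = 0 *)
    and Hlow0_le_Hup0: "0 < c0 \<longrightarrow> psd (Hup0 - Hlow0)"
    and quadratic: "\<forall>j. Hup j = Hlow j \<and> c j = 0"
    and U_symmetric: "uminus ` U = U"
    and U_neighborhood: "0 \<in> interior U"
    and U_measurable: "U \<in> sets lebesgue"
    and \<Omega>U_measurable: "\<Omega> + U \<in> sets lebesgue"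
    and \<Omega>U_subset: "\<Omega> + U \<subseteq> \<Omega>\<^sub>0"
  shows "\<forall>X\<in>space \<nu>. \<forall>l\<in>A.
    uLNML f g \<Omega> U Hup0 Hup c0 c r X l \<le> LNML \<nu> f g \<Omega> X l
      + (ereal (c0 + 1/2 * ln (det Hup0 / det Hlow0)) - elog (R_factor r Hup0 U)
         - elog (INF \<psi>\<in>\<Omega> + U. T_mass \<nu> f \<Omega> \<theta>hat (Inf A) \<psi>))"
proof (intro ballI)
  fix X l assume X: "X \<in> space \<nu>" and l: "l \<in> A"
  have \<theta>hat: "\<theta>hat Y l \<in> \<Omega>" if "Y \<in> space \<nu>" for Y
    using minimizer l that by (simp add: is_arg_min_def)
  \<comment> \<open>A single point of \<Omega> serves as expansion point for the penalties, as the
    place where the curvatures are compared, and as a parameter at which exp(-f) has total mass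
    1.\<close>
  define \<theta>0 where "\<theta>0 = \<theta>hat X l"
  have \<theta>0: "\<theta>0 \<in> \<Omega>" using \<theta>hat[OF X] by (simp add: \<theta>0_def)
  have l0: "0 \<le> l $ j" for j using A_nonneg l by simp
  have "Inf A \<le> l"
  proof (rule cInf_lower[OF l])
    show "bdd_below A" using A_nonneg by (intro bdd_belowI[of _ 0]) (simp add: less_eq_vec_def)
  qed
  have f_finite: "\<bar>f Y \<theta>\<bar> \<noteq> \<infinity>" if "Y \<in> space \<nu>" "\<theta> \<in> \<Omega>" for Y \<theta>
    using upper_smooth_not_PInfty[of Hup0 c0 r \<Omega> "f Y"] f_upper f_values that by fastforce
  \<comment> \<open>Being quadratic polynomials, the penalties are real-valued and Borel measurable,
    also outside \<Omega>.\<close>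
  have "\<forall>j. \<exists>\<gamma> :: real^'p \<Rightarrow> real. \<gamma> \<in> borel_measurable borel \<and> (\<forall>\<psi>. g j \<psi> = ereal (\<gamma> \<psi>))"
  proof
    fix j
    have "upper_smooth (Hlow j) 0 (\<lambda>_. 0) \<Omega> (g j)" "strongly_convex (Hlow j) \<Omega> (g j)" "g j \<theta>0 \<noteq> -\<infinity>"
      using g_upper g_convex quadratic g_values by metis+
    then obtain a b where "\<And>\<psi>. g j \<psi> = ereal (a + b \<bullet> (\<psi> - \<theta>0) + 1/2 * ((\<psi> - \<theta>0) \<bullet> (Hlow j *v (\<psi> - \<theta>0))))"
      using quadratic_penaltyE[OF _ _ \<theta>0] by blast
    moreover have "(\<lambda>\<psi>. a + b \<bullet> (\<psi> - \<theta>0) + 1/2 * ((\<psi> - \<theta>0) \<bullet> (Hlow j *v (\<psi> - \<theta>0)))) \<in> borel_measurable borel"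
      by (intro borel_measurable_continuous_onI continuous_intros)
    ultimately show "\<exists>\<gamma>. \<gamma> \<in> borel_measurable borel \<and> (\<forall>\<psi>. g j \<psi> = ereal (\<gamma> \<psi>))" by blast
  qed
  then obtain \<gamma> :: "'d \<Rightarrow> real^'p \<Rightarrow> real" where \<gamma>: "\<And>j. \<gamma> j \<in> borel_measurable borel" "\<And>j \<psi>. g j \<psi> = ereal (\<gamma> j \<psi>)"
    by metis
  define P where "P \<theta> = (\<Sum>j\<in>UNIV. l $ j * \<gamma> j \<theta>)" for \<theta>
  have P [measurable]: "P \<in> borel_measurable borel" unfolding P_def using \<gamma>(1) by measurable
  have pen: "penalty g \<theta> l = ereal (P \<theta>)" for \<theta>
    using \<gamma>(2) by (simp add: penalty_ereal P_def)

  define G where "G = (\<Sum>j\<in>UNIV. (l $ j) *\<^sub>R Hlow j)"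
  have G: "psd G" unfolding G_def using Hlow_psd l0 by (intro psd_sum psd_scaleR) auto
  define H where "H = H_comb Hlow0 Hlow l"
  have H: "H = Hlow0 + G" by (simp add: H_def H_comb_def G_def)
  have Hup: "H_comb Hup0 Hup l = Hup0 + G" using quadratic by (simp add: H_comb_def G_def)
  have pdH: "pd H" unfolding H using Hlow0_pd G by (rule pd_add_psd)
  have le: "psd (Hup0 - Hlow0)"
  proof (cases "c0 = 0")
    case True
    then show ?thesis
      using upper_smooth_strongly_convex_psd[of Hup0 r \<Omega> "f X" Hlow0 \<theta>0]
        f_upper f_convex Hlow0_pd X \<theta>0 f_finite[OF X \<theta>0] by (auto simp: pd_def)
  next
    case False
    moreover have "0 \<le> c0" using f_upper X by (auto simp: upper_smooth_def)
    ultimately show ?thesis using Hlow0_le_Hup0 by simp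
  qed

  define E where "E = {Y \<in> space \<nu>. \<theta>hat Y (Inf A) \<in> interior \<Omega>}"
  define m where "m Y = (SUP \<theta>\<in>\<Omega>. eexp (- f Y \<theta> - penalty g \<theta> l))" for Y
  define w where "w = (2 * pi) powr (real CARD('p) / 2)"
  define k where "k = (INF \<psi>\<in>\<Omega> + U. T_mass \<nu> f \<Omega> \<theta>hat (Inf A) \<psi>)"
  define I where "I = (\<integral>\<^sup>+\<theta>\<in>\<Omega> + U. eexp (- penalty g \<theta> l) \<partial>lebesgue)"

  have bound: "eexp (- f Y \<psi> - ereal (P \<psi>)) \<le> m Y * gaussian H (\<psi> - \<theta>hat Y l)" if "Y \<in> E" for Y \<psi>
  proof -
    have Y: "Y \<in> space \<nu>" "\<theta>hat Y (Inf A) \<in> interior \<Omega>" using that by (auto simp: E_def)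
    define \<theta> where "\<theta> = \<theta>hat Y l"
    \<comment> \<open>\<open>E\<close> only tests the minimizer at \<open>Inf A\<close>; the regular
      penalty assumption carries interiority up to \<open>l\<close>.\<close>
    have int: "\<theta> \<in> interior \<Omega>"
      unfolding \<theta>_def using regular_penalty Y l \<open>Inf A \<le> l\<close> by blast
    have \<theta>: "\<theta> \<in> \<Omega>" using int interior_subset by blast
    have "strongly_convex H \<Omega> (\<lambda>\<theta>. f Y \<theta> + penalty g \<theta> l)"
      unfolding H_def using f_convex g_convex f_values Y(1) \<gamma>(2) l0
      by (intro strongly_convex_plus_penalty) auto
    then have "f Y \<theta> + penalty g \<theta> l + ereal (1/2 * ((\<psi> - \<theta>) \<bullet> (H *v (\<psi> - \<theta>)))) \<le> f Y \<psi> + penalty g \<psi> l"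
    proof (rule strongly_convex_growth[OF _ int])
      show "\<bar>f Y \<theta>' + penalty g \<theta>' l\<bar> \<noteq> \<infinity>" if "\<theta>' \<in> \<Omega>" for \<theta>'
        using f_finite[OF Y(1) that] by (auto simp: pen)
      show "f Y \<psi> + penalty g \<psi> l \<noteq> -\<infinity>" using f_values Y(1) by (simp add: pen)
      show "f Y \<theta> + penalty g \<theta> l \<le> f Y \<theta>' + penalty g \<theta>' l" if "\<theta>' \<in> \<Omega>" for \<theta>'
        using minimizer Y(1) l that by (auto simp: is_arg_min_def \<theta>_def not_less)
    qed
    moreover obtain a where a: "f Y \<theta> = ereal a" using f_finite[OF Y(1) \<theta>] by auto
    ultimately have "- f Y \<psi> - ereal (P \<psi>) \<le> ereal (- a - P \<theta> - 1/2 * ((\<psi> - \<theta>) \<bullet> (H *v (\<psi> - \<theta>))))"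
      by (cases "f Y \<psi>") (auto simp: pen)
    then have "eexp (- f Y \<psi> - ereal (P \<psi>)) \<le> eexp (ereal (- a - P \<theta> - 1/2 * ((\<psi> - \<theta>) \<bullet> (H *v (\<psi> - \<theta>)))))"
      by (rule eexp_mono)
    also have "\<dots> = eexp (- f Y \<theta> - penalty g \<theta> l) * gaussian H (\<psi> - \<theta>)"
      by (simp add: a pen gaussian_def flip: ennreal_mult exp_add)
    also have "\<dots> \<le> m Y * gaussian H (\<psi> - \<theta>)"
      unfolding m_def using \<theta> by (intro mult_right_mono SUP_upper) auto
    finally show ?thesis by (simp add: \<theta>_def)
  qed

  have f_section: "(\<lambda>Y. f Y \<psi>) \<in> borel_measurable \<nu>" for \<psi>
    using measurable_compose[OF measurable_Pair2'[of \<psi> lebesgue \<nu>] f_measurable] by simp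
  have mass_1: "(\<integral>\<^sup>+Y. eexp (- f Y \<theta>0) \<partial>\<nu>) = 1"
    using log_loss \<theta>0 \<Omega>_subset by blast
  \<comment> \<open>Finiteness of \<open>f\<close> on \<Omega> makes exp(-f) at
    \<open>\<theta>0\<close> strictly positive, and log-loss makes it integrable.\<close>
  have \<nu>: "sigma_finite_measure \<nu>"
  proof (rule sigma_finite_if_positive_integrable)
    show "(\<lambda>Y. eexp (- f Y \<theta>0)) \<in> borel_measurable \<nu>" using f_section by measurable
    show "(\<integral>\<^sup>+Y. eexp (- f Y \<theta>0) \<partial>\<nu>) \<noteq> \<infinity>" by (simp add: mass_1)
    show "eexp (- f Y \<theta>0) > 0" if "Y \<in> space \<nu>" for Y
      using f_finite[OF that \<theta>0] by (cases "f Y \<theta>0") auto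
  qed
  have "k * I \<le> (\<integral>\<^sup>+x. gaussian H x \<partial>lborel) * (\<integral>\<^sup>+Y. m Y \<partial>\<nu>)"
    using mass_times_penalty_integral_le[OF \<nu> f_measurable interior_measurable[folded E_def] \<Omega>U_measurable P pdH bound]
    by (simp add: k_def I_def T_mass_def pen flip: E_def)
  then have main: "k * I \<le> ennreal (w / sqrt (det H)) * normalizer \<nu> f g \<Omega> l"
    by (simp add: gaussian_integral(2)[OF pdH] normalizer_def m_def w_def)

  \<comment> \<open>The origin lies in \<open>U\<close>, so the infimum \<open>k\<close> is at most
    the full mass 1 at \<open>\<theta>0\<close>; hence \<open>- elog k\<close> cannot be
    -\<infinity>.\<close>
  have "\<theta>0 \<in> \<Omega> + U"
    using set_plus_intro[OF \<theta>0, of 0 U] U_neighborhood interior_subset by auto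
  then have "k \<le> T_mass \<nu> f \<Omega> \<theta>hat (Inf A) \<theta>0"
    unfolding k_def by (rule INF_lower)
  also have "\<dots> \<le> (\<integral>\<^sup>+Y. eexp (- f Y \<theta>0) \<partial>\<nu>)"
    unfolding T_mass_def by (intro nn_integral_mono) (auto simp: indicator_def)
  finally have "k \<le> 1" by (simp only: mass_1)
  then have k: "k \<noteq> \<infinity>" by (auto simp: top_unique)

  define a where "a = exp (c_comb c0 c l) * sqrt (det (H_comb Hup0 Hup l))"
  define C where "C = c0 + 1/2 * ln (det Hup0 / det Hlow0)"
  have det_pos: "det (Hup0 + G) > 0" "det H > 0" "det Hup0 > 0" "det Hlow0 > 0"
    using gaussian_integral(1) pd_add_psd[OF Hup0_pd G] pdH Hup0_pd Hlow0_pd by auto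
  have w: "w > 0" by (simp add: w_def)
  have "c_comb c0 c l = c0" using quadratic by (simp add: c_comb_def)
  \<comment> \<open>The power of \<open>2 * pi\<close> from the Gaussian integral cancels the one in
    \<open>normalizer_bound\<close>, leaving the root of a determinant ratio.\<close>
  then have "a * (w / sqrt (det H)) / w = exp c0 * sqrt (det (Hup0 + G) / det H)"
    using w by (simp add: a_def Hup real_sqrt_divide)
  also have "\<dots> \<le> exp c0 * sqrt (det Hup0 / det Hlow0)"
    unfolding H using det_ratio_antimono[OF Hlow0_pd le G] by simp
  also have "\<dots> = exp C"
    using det_pos by (simp add: C_def exp_add powr_half_sqrt[symmetric] powr_def)
  finally have C: "a * (w / sqrt (det H)) / w \<le> exp C" .
  have "elog (normalizer_bound g \<Omega> U Hup0 Hup c0 c r l) \<le> elog (normalizer \<nu> f g \<Omega> l) + (ereal C - elog (R_factor r Hup0 U) - elog k)"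
    using elog_bound[OF main R_factor_finite[OF Hup0_pd] k _ w _ C, of r U] det_pos w
    by (simp add: normalizer_bound_def a_def Hup I_def w_def)
  \<comment> \<open>The minimal penalised loss is a common summand and is added by monotonicity, so
    no ereal subtraction occurs.\<close>
  then show "uLNML f g \<Omega> U Hup0 Hup c0 c r X l \<le> LNML \<nu> f g \<Omega> X l
      + (ereal (c0 + 1/2 * ln (det Hup0 / det Hlow0)) - elog (R_factor r Hup0 U)
         - elog (INF \<psi>\<in>\<Omega> + U. T_mass \<nu> f \<Omega> \<theta>hat (Inf A) \<psi>))"
    unfolding uLNML_def LNML_def add.assoc k_def C_def by (rule add_left_mono)
qed

end
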